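(* Let $d\ge 2$ be an integer and $1\le p<\infty$. Let $s_p$ be a real number such that $s_p>\frac{d}{2(d+1)}$ if $1\le p\le \frac{2(d+1)}{d}$, and $s_p>\frac d2-\frac dp$ if $p\ge \frac{2(d+1)}{d}$. Then there is a constant $C$ (depending on $d,p,s_p$ but not on $N$) such that for every integer $N\ge 1$, $$\Big\|\sup_{0<t<1}\Big|\prod_{j=1}^{d}\sum_{n_j=1}^{N}e^{2\pi i(n_jx_j+n_j^2t)}\Big|\Big\|_{L^{p}(\mathbb{T}^{d},\,dx)}\le C\, N^{\frac d2+s_p},$$ where $x=(x_1,\dots,x_d)\in\mathbb{T}^d=\mathbb{R}^d/\mathbb{Z}^d$. *)

theory Defs
  imports "HOL-Analysis.Analysis"
begin

text \<open>
  The torus \<open>(\<real>/\<int>)\<^sup>d\<close> is represented by the fundamental domain \<open>[0,1)\<^sup>d\<close> with Lebesgue measure;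
  a point is a function on the index set \<open>{1..d}\<close>. All functions considered below are
  \<open>1\<close>-periodic in each coordinate.
\<close>
definition torus :: "nat \<Rightarrow> (nat \<Rightarrow> real) measure" where
  "torus d = Pi\<^sub>M {1..d} (\<lambda>_. restrict_space lborel {0..<1})"

definition weyl_sum :: "nat \<Rightarrow> real \<Rightarrow> real \<Rightarrow> complex" where
  "weyl_sum N x t =
     (\<Sum>n=1..N. exp (2 * of_real pi * \<i> * of_real (real n * x + (real n)\<^sup>2 * t)))"

text \<open>
  The supremum is a real one; it is over a set bounded by \<open>N\<^sup>d\<close>, see
  \<open>weyl_maximal_bdd_above\<close> below.
\<close>
definition weyl_maximal :: "nat \<Rightarrow> nat \<Rightarrow> (nat \<Rightarrow> real) \<Rightarrow> real" where
  "weyl_maximal d N x = (SUP t\<in>{0<..<1}. cmod (\<Prod>j=1..d. weyl_sum N (x j) t))"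

text \<open>
  The norm takes the value \<open>\<infinity>\<close> when the integral diverges, so that an upper bound on it is
  never vacuous.
\<close>
definition Lp_norm :: "real \<Rightarrow> 'a measure \<Rightarrow> ('a \<Rightarrow> real) \<Rightarrow> ennreal" where
  "Lp_norm p M f =
     (let I = (\<integral>\<^sup>+ x. ennreal (\<bar>f x\<bar> powr p) \<partial>M)
      in if I = \<infinity> then \<infinity> else ennreal (enn2real I powr (1 / p)))"

lemma norm_weyl_sum_le: "cmod (weyl_sum N x t) \<le> real N"
proof -
  have "cmod (weyl_sum N x t) \<le> (\<Sum>n=1..N. 1)"
    unfolding weyl_sum_def by (rule sum_norm_le) (simp add: norm_exp_eq_Re)
  then show ?thesis by simp
qed

lemma norm_prod_weyl_sum_le: "cmod (\<Prod>j=1..d. weyl_sum N (x j) t) \<le> real N ^ d"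
proof -
  have "cmod (\<Prod>j=1..d. weyl_sum N (x j) t) = (\<Prod>j=1..d. cmod (weyl_sum N (x j) t))"
    by (simp add: prod_norm)
  also have "\<dots> \<le> (\<Prod>j=1..d. real N)"
    by (rule prod_mono) (simp add: norm_weyl_sum_le)
  finally show ?thesis by simp
qed

lemma weyl_maximal_bdd_above:
  fixes d :: nat
  shows
  "bdd_above ((\<lambda>t. cmod (\<Prod>j=1..d. weyl_sum N (x j) t)) ` T)"
  by (rule bdd_aboveI2) (rule norm_prod_weyl_sum_le)

lemma weyl_maximal_eq_countable_SUP:
  "weyl_maximal d N x = (SUP t\<in>{0<..<1} \<inter> \<rat>. cmod (\<Prod>j=1..d. weyl_sum N (x j) t))"
    (is "_ = (SUP t\<in>_. ?f t)")
proof (rule antisym)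
  have ne: "{0<..<1} \<inter> \<rat> \<noteq> ({} :: real set)"
    using Rats_dense_in_real[of 0 1] by auto
  have cont: "continuous_on UNIV ?f"
    unfolding weyl_sum_def by (intro continuous_intros)
  have "?f t \<le> (SUP t\<in>{0<..<1} \<inter> \<rat>. ?f t)" (is "_ \<le> ?S") if t: "t \<in> {0<..<1}" for t
  proof (rule ccontr)
    assume "\<not> ?thesis"
    then have "t \<in> {0<..<1} \<inter> {t. ?S < ?f t}" using t by simp
    moreover have "open ({0<..<1} \<inter> {t. ?S < ?f t})"
      by (intro open_Int open_greaterThanLessThan open_Collect_less continuous_on_const cont)
    ultimately obtain e where e: "e > 0" "ball t e \<subseteq> {0<..<1} \<inter> {t. ?S < ?f t}"
      by (meson openE)
    obtain q where q: "q \<in> \<rat>" "t < q" "q < t + e"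
      using Rats_dense_in_real[of t "t + e"] e by auto
    then have "q \<in> ball t e" by (simp add: dist_real_def)
    then have "q \<in> {0<..<1} \<inter> \<rat>" "?S < ?f q" using e(2) q(1) by auto
    moreover have "?f q \<le> ?S"
      using calculation(1) weyl_maximal_bdd_above by (rule cSUP_upper)
    ultimately show False by simp
  qed
  then show "weyl_maximal d N x \<le> (SUP t\<in>{0<..<1} \<inter> \<rat>. ?f t)"
    unfolding weyl_maximal_def by (intro cSUP_least) auto
  show "(SUP t\<in>{0<..<1} \<inter> \<rat>. ?f t) \<le> weyl_maximal d N x"
    unfolding weyl_maximal_def
    by (rule cSUP_subset_mono[OF ne weyl_maximal_bdd_above]) auto
qed

lemma weyl_maximal_measurable: "weyl_maximal d N \<in> borel_measurable (torus d)"
proof -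
  have c: "(\<lambda>x. x j) \<in> borel_measurable (torus d)" if "j \<in> {1..d}" for j
  proof -
    have "(\<lambda>x. x j) \<in> torus d \<rightarrow>\<^sub>M restrict_space lborel {0..<1}"
      unfolding torus_def using that by (rule measurable_component_singleton)
    then show ?thesis
      by (simp add: measurable_restrict_space2_iff)
  qed
  have m: "(\<lambda>x. cmod (\<Prod>j=1..d. weyl_sum N (x j) t)) \<in> borel_measurable (torus d)" for t
  proof -
    have "continuous_on UNIV (\<lambda>y. weyl_sum N y t)"
      unfolding weyl_sum_def by (intro continuous_intros)
    then have w: "(\<lambda>y. weyl_sum N y t) \<in> borel_measurable borel"
      by (rule borel_measurable_continuous_onI)
    have "(\<lambda>x. weyl_sum N (x j) t) \<in> borel_measurable (torus d)" if "j \<in> {1..d}" for j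
      using measurable_compose[OF c[OF that] w] .
    then show ?thesis by (intro borel_measurable_norm[THEN measurable_compose[rotated]] borel_measurable_prod) auto
  qed
  have "(\<lambda>x. SUP t\<in>{0<..<1} \<inter> \<rat>. cmod (\<Prod>j=1..d. weyl_sum N (x j) t))
          \<in> borel_measurable (torus d)"
    by (rule borel_measurable_cSUP[OF _ m weyl_maximal_bdd_above])
       (simp add: countable_Int2 countable_rat)
  then show ?thesis
    by (simp add: weyl_maximal_eq_countable_SUP[abs_def])
qed

end

theory Submission
  imports Defs "HOL-Analysis.Kronecker_Approximation_Theorem" "HOL-Analysis.Harmonic_Numbers"
begin

text \<open>
  Write \<open>\<Lambda> = 1 + ln (2 * N)\<close> and let \<open>\<parallel>y\<parallel>\<close> be the distance from \<open>y\<close> to the nearest integer.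
  Choose \<open>q \<le> 2 * N\<close> with \<open>\<bar>2 * t - a / q\<bar> \<le> 1 / (2 * q * N)\<close>. Weyl differencing, in which the differences
  divisible by \<open>q\<close> are kept together and reassembled into sums over residue classes modulo \<open>q\<close>, gives
  \<open>\<bar>weyl_sum N x t\<bar>\<^sup>2 \<lesssim> \<Lambda> * min (N\<^sup>2 / q) (N / \<parallel>2 * q * x\<parallel>)\<close>, where \<open>q\<close> depends on \<open>t\<close> alone and hence
  serves all coordinates \<open>x j\<close> at once. The supremum over \<open>t\<close> is therefore dominated by a sum over
  \<open>q\<close> of products of functions of a single coordinate. At the critical exponent \<open>2 + 2 / d\<close> one factor
  \<open>N\<^sup>2 / q\<close> is taken out, and the rest integrates to \<open>(N * \<Lambda>\<^sup>2)\<^sup>d\<close> up to constants; summing \<open>1 / q\<close> costs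
  another logarithm. The other exponents follow by comparison with the trivial bound \<open>N\<^sup>d\<close> and
  with the constant function at the critical height.
\<close>

section \<open>Additive characters and the size of \<open>nu\<close>\<close>

definition e1 :: "real \<Rightarrow> complex" where
  "e1 y = cis (2 * pi * y)"

text \<open>A substitute for the distance to the nearest integer, to which it is comparable.\<close>
definition nu :: "real \<Rightarrow> real" where
  "nu y = \<bar>sin (pi * y)\<bar>"

lemma e1_add: "e1 (x + y) = e1 x * e1 y"
  by (simp add: e1_def cis_mult ring_distribs)

lemma cnj_e1: "cnj (e1 x) = e1 (- x)"
  by (simp add: e1_def cis_cnj)

lemma norm_e1 [simp]: "cmod (e1 x) = 1"
  by (simp add: e1_def)

lemma e1_of_nat_mult: "e1 (real n * x) = e1 x ^ n"
  by (simp add: e1_def Complex.DeMoivre mult.left_commute)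

lemma norm_one_minus_e1: "cmod (1 - e1 y) = 2 * nu y"
proof -
  have "(cmod (1 - e1 y))\<^sup>2 = (1 - cos (2 * pi * y))\<^sup>2 + (sin (2 * pi * y))\<^sup>2"
    by (simp add: e1_def cmod_power2)
  also have "\<dots> = 2 - 2 * cos (2 * (pi * y))"
    using sin_cos_squared_add[of "2 * pi * y"] by (simp add: power2_eq_square algebra_simps)
  also have "\<dots> = (2 * nu y)\<^sup>2"
    unfolding cos_double_sin nu_def by (simp add: power_mult_distrib)
  finally show ?thesis
    by (rule power2_eq_imp_eq) (simp_all add: nu_def)
qed

lemma nu_nonneg [simp]: "0 \<le> nu y"
  and nu_le_one: "nu y \<le> 1"
  and nu_minus [simp]: "nu (- y) = nu y"
  by (simp_all add: nu_def)

text \<open>Subadditivity is what lets \<open>nu\<close> replace the distance to the nearest integer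
  in triangle inequalities. It comes from the addition formula for the sine, with both cosines
  bounded by 1.\<close>

lemma nu_add_le: "nu (x + y) \<le> nu x + nu y"
proof -
  have "nu (x + y) \<le> \<bar>sin (pi * x)\<bar> * \<bar>cos (pi * y)\<bar> + \<bar>cos (pi * x)\<bar> * \<bar>sin (pi * y)\<bar>"
    unfolding nu_def ring_distribs sin_add abs_mult[symmetric] by (rule abs_triangle_ineq)
  also have "\<dots> \<le> nu x + nu y"
    unfolding nu_def by (intro add_mono mult_left_le mult_left_le_one_le) auto
  finally show ?thesis .
qed

lemma nu_double_le: "nu (2 * x) \<le> 2 * nu x"
  using nu_add_le[of x x] by simp

lemma nu_le_pi_abs: "nu x \<le> pi * \<bar>x\<bar>"
  using abs_sin_x_le_abs_x[of "pi * x"] by (simp add: nu_def abs_mult)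

lemma nu_add_int [simp]: "nu (x + of_int k) = nu x"
proof -
  have "cos (pi * of_int k) = 1 \<or> cos (pi * of_int k) = - 1"
    using sin_zero_abs_cos_one[of "pi * of_int k"] sin_int_times_real sin_npi_int
    by (auto simp: abs_if split: if_splits)
  then show ?thesis
    by (auto simp: nu_def ring_distribs sin_add sin_npi_int)
qed

lemma nu_int_add [simp]: "nu (of_int k + x) = nu x"
  by (subst add.commute) simp

text \<open>The sine is concave on \<open>{0..pi}\<close>, so between 0 and \<open>pi / 2\<close>
  its graph lies above the chord.\<close>

lemma sin_pi_ge:
  assumes "0 \<le> y" "y \<le> 1 / 2"
  shows "2 * y \<le> sin (pi * y)"
proof -
  have "convex_on {0..pi} (\<lambda>x. - sin x)"
    by (rule f''_ge0_imp_convex[where f' = "\<lambda>x. - cos x" and f'' = sin])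
       (auto intro!: derivative_eq_intros sin_ge_zero)
  from convex_onD[OF this, of "2 * y" 0 "pi / 2"] assms
  show ?thesis by (simp add: mult_ac)
qed

lemma nu_ge:
  assumes "0 \<le> y" "y \<le> 1"
  shows "min (2 * y) (2 * (1 - y)) \<le> nu y"
proof (cases "y \<le> 1 / 2")
  case True
  then show ?thesis using sin_pi_ge[of y] assms by (simp add: nu_def)
next
  case False
  have "sin (pi * y) = sin (pi * (1 - y))" by (simp add: right_diff_distrib sin_diff)
  then show ?thesis using sin_pi_ge[of "1 - y"] assms False by (simp add: nu_def)
qed

section \<open>Geometric sums and sums with slowly varying increments\<close>

text \<open>Multiplication by \<open>1 - e1 y\<close>, of modulus \<open>2 * nu y\<close>, leaves a
  difference of two numbers of modulus 1. The product form of the bound also covers integral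
  \<open>y\<close>, where \<open>nu y\<close> vanishes.\<close>

lemma norm_geometric_e1:
  "cmod (\<Sum>n=1..M. e1 (c + real n * y)) * nu y \<le> 1"
proof -
  have "(1 - e1 y) * (\<Sum>n=1..M. e1 (c + real n * y)) = e1 c * (e1 y * ((1 - e1 y) * (\<Sum>n<M. e1 y ^ n)))"
  proof -
    have "(\<Sum>n=1..M. e1 (c + real n * y)) = (\<Sum>n<M. e1 c * (e1 y * e1 y ^ n))"
      by (rule sum.reindex_bij_witness[of _ Suc "\<lambda>n. n - 1"])
         (auto simp: e1_add e1_of_nat_mult simp flip: power_Suc)
    then show ?thesis by (simp add: sum_distrib_left mult_ac)
  qed
  also have "\<dots> = e1 c * (e1 y * (1 - e1 y ^ M))"
    by (simp add: one_diff_power_eq)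
  finally have "2 * nu y * cmod (\<Sum>n=1..M. e1 (c + real n * y)) = cmod (1 - e1 y ^ M)"
    unfolding norm_one_minus_e1[symmetric] norm_mult[symmetric] by (simp add: norm_mult)
  also have "\<dots> \<le> 2"
    using norm_triangle_ineq4[of 1 "e1 y ^ M"] by (simp add: norm_power)
  finally show ?thesis by (simp add: mult_ac)
qed

text \<open>A discrete Kuzmin--Landau inequality: Abel summation turns \<open>z m = c m * (z m - z (m + 1))\<close>,
  with \<open>c m = 1 / (1 - w m)\<close>, into a sum of the increments of \<open>c\<close>.\<close>
lemma kuzmin_landau:
  fixes z w :: "nat \<Rightarrow> complex"
  assumes z: "\<And>m. cmod (z m) = 1" and step: "\<And>m. m < D \<Longrightarrow> z (Suc m) = z m * w m"
    and rho: "\<rho> > 0" "\<And>m. m < D \<Longrightarrow> cmod (1 - w m) \<ge> \<rho>"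
    and eta: "\<And>m. Suc m < D \<Longrightarrow> cmod (w (Suc m) - w m) \<le> \<eta>" "0 \<le> \<eta>"
    and bd: "real D * \<eta> \<le> \<rho>" and "\<rho> \<le> 1"
  shows "cmod (\<Sum>m\<le>D. z m) \<le> 4 / \<rho>"
proof (cases D)
  case 0
  then show ?thesis using z[of 0] rho(1) \<open>\<rho> \<le> 1\<close> by (simp add: field_simps)
next
  case (Suc D')
  define c where "c m = 1 / (1 - w m)" for m
  have nz: "1 - w m \<noteq> 0" if "m < D" for m using rho(1) rho(2)[OF that] by auto
  have cz: "z m = c m * (z m - z (Suc m))" if "m < D" for m
    using nz[OF that] step[OF that] by (simp add: c_def field_simps)
  have c_le: "cmod (c m) \<le> 1 / \<rho>" if "m < D" for m
    using rho(1) rho(2)[OF that] by (simp add: c_def norm_divide frac_le)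
  have c_diff: "cmod (c (Suc m) - c m) \<le> \<eta> / \<rho>\<^sup>2" if "Suc m < D" for m
  proof -
    have "c (Suc m) - c m = (w (Suc m) - w m) / ((1 - w (Suc m)) * (1 - w m))"
      using nz[of m] nz[of "Suc m"] that unfolding c_def by (simp add: divide_simps)
    also have "cmod \<dots> \<le> \<eta> / (\<rho> * \<rho>)"
      unfolding norm_divide norm_mult using rho that eta
      by (intro frac_le mult_mono mult_pos_pos) (auto intro: order_trans)
    finally show ?thesis by (simp add: power2_eq_square)
  qed
  \<comment> \<open>The boundary term \<open>c k * z (Suc k)\<close> stays on the left, so that
    passing from \<open>k\<close> to \<open>Suc k\<close> adds just one increment of
    \<open>c\<close>.\<close>
  have ind: "cmod ((\<Sum>m\<le>k. z m) + c k * z (Suc k)) \<le> 1 / \<rho> + real k * (\<eta> / \<rho>\<^sup>2)" if "k < D" for k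
    using that
  proof (induction k)
    case 0
    then have "z 0 + c 0 * z (Suc 0) = c 0 * z 0" using cz[of 0] by (simp add: algebra_simps)
    then show ?case using c_le[of 0] 0 z[of 0] by (simp add: norm_mult)
  next
    case (Suc k)
    have "(\<Sum>m\<le>Suc k. z m) + c (Suc k) * z (Suc (Suc k))
        = ((\<Sum>m\<le>k. z m) + c k * z (Suc k)) + (c (Suc k) - c k) * z (Suc k)"
      using cz[of "Suc k"] Suc.prems by (simp add: algebra_simps)
    also have "cmod \<dots> \<le> (1 / \<rho> + real k * (\<eta> / \<rho>\<^sup>2)) + \<eta> / \<rho>\<^sup>2"
      using Suc c_diff[of k] z[of "Suc k"]
      by (intro norm_triangle_mono[of "_ + _"]) (auto simp: norm_mult)
    finally show ?case by (simp add: algebra_simps add_divide_distrib)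
  qed
  \<comment> \<open>Nothing is known about \<open>c D\<close>, so the induction is used at
    \<open>D' = D - 1\<close> and the last term \<open>z D\<close> is added separately.\<close>
  have "(\<Sum>m\<le>D. z m) = ((\<Sum>m\<le>D'. z m) + c D' * z D) + (1 - c D') * z D"
    by (simp add: Suc algebra_simps)
  also have "cmod \<dots> \<le> (1 / \<rho> + real D' * (\<eta> / \<rho>\<^sup>2)) + (1 + 1 / \<rho>)"
  proof (rule norm_triangle_mono)
    show "cmod ((1 - c D') * z D) \<le> 1 + 1 / \<rho>"
      using c_le[of D'] Suc z[of D] norm_triangle_ineq4[of 1 "c D'"] by (simp add: norm_mult)
  qed (use ind[of D'] Suc in auto)
  also have "real D' * (\<eta> / \<rho>\<^sup>2) \<le> \<rho> / \<rho>\<^sup>2"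
  proof -
    have "real D' * \<eta> \<le> \<rho>" using bd eta(2) Suc by (simp add: algebra_simps)
    then show ?thesis by (simp add: divide_right_mono)
  qed
  also have "\<rho> / \<rho>\<^sup>2 = 1 / \<rho>" using rho(1) by (simp add: power2_eq_square)
  also have "1 / \<rho> + 1 / \<rho> + (1 + 1 / \<rho>) \<le> 4 / \<rho>" using rho(1) \<open>\<rho> \<le> 1\<close> by (simp add: field_simps)
  finally show ?thesis by simp
qed

lemma norm_e1_diff_le: "cmod (e1 x - e1 y) \<le> 2 * pi * \<bar>x - y\<bar>"
proof -
  have "e1 x - e1 y = - (e1 y * (1 - e1 (x - y)))"
    by (simp add: algebra_simps flip: e1_add)
  then have "cmod (e1 x - e1 y) = 2 * nu (x - y)"
    by (simp add: norm_mult norm_one_minus_e1)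
  then show ?thesis using nu_le_pi_abs[of "x - y"] by simp
qed

section \<open>Residue classes and Weyl differencing\<close>

definition residue_class :: "nat \<Rightarrow> nat \<Rightarrow> nat \<Rightarrow> nat set" where
  "residue_class N Q r = {n \<in> {1..N}. n mod Q = r}"

lemma finite_residue_class [simp]: "finite (residue_class N Q r)"
  by (simp add: residue_class_def)

text \<open>The start \<open>k\<close> is the least element of the class and \<open>D\<close> the
  largest index that does not leave \<open>{1..N}\<close>. Indexing by \<open>{..D}\<close> is the
  form that \<open>kuzmin_landau\<close> needs.\<close>

lemma residue_class_progression:
  assumes "residue_class N Q r \<noteq> {}" "0 < Q"
  obtains k D where "1 \<le> k" "k + Q * D \<le> N" "residue_class N Q r = (\<lambda>m. k + Q * m) ` {..D}"
proof -
  define k where "k = Min (residue_class N Q r)"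
  define D where "D = (N - k) div Q"
  have k: "k \<in> residue_class N Q r" unfolding k_def using assms by (intro Min_in) auto
  have le: "Q * D \<le> N - k" unfolding D_def by simp
  show ?thesis
  proof (rule that[of k D])
    show "1 \<le> k" "k + Q * D \<le> N" using k le by (auto simp: residue_class_def)
    show "residue_class N Q r = (\<lambda>m. k + Q * m) ` {..D}"
    proof (intro equalityI subsetI)
      fix n assume n: "n \<in> residue_class N Q r"
      then have "k \<le> n" unfolding k_def by (intro Min_le) auto
      moreover from n k have "n mod Q = k mod Q" by (simp add: residue_class_def)
      ultimately obtain m where m: "n = k + Q * m" by (metis mod_eq_nat1E)
      have "m \<le> D" unfolding D_def using n m assms(2)
        by (auto simp: residue_class_def less_eq_div_iff_mult_less_eq mult.commute)
      with m show "n \<in> (\<lambda>m. k + Q * m) ` {..D}" by blast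
    next
      fix n assume "n \<in> (\<lambda>m. k + Q * m) ` {..D}"
      then obtain m where m: "m \<le> D" "n = k + Q * m" by blast
      have "Q * m \<le> Q * D" using m by simp
      moreover have "k \<le> N" using k by (simp add: residue_class_def)
      ultimately have "n \<le> N" using le m(2) by linarith
      then show "n \<in> residue_class N Q r" using k m by (auto simp: residue_class_def)
    qed
  qed
qed

lemma card_residue_class_le:
  assumes "0 < Q"
  shows "real (card (residue_class N Q r)) \<le> real N / real Q + 1"
proof (cases "residue_class N Q r = {}")
  case False
  then obtain k D where kD: "1 \<le> k" "k + Q * D \<le> N" "residue_class N Q r = (\<lambda>m. k + Q * m) ` {..D}"
    using residue_class_progression assms by metis
  have "card (residue_class N Q r) \<le> D + 1"
    unfolding kD(3) using card_image_le[of "{..D}"] by simp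
  moreover have "real (D * Q) \<le> real N" using kD by (simp only: of_nat_le_iff) (simp add: mult.commute)
  then have "real D \<le> real N / real Q" using assms by (simp add: pos_le_divide_eq)
  ultimately show ?thesis by linarith
qed simp

lemma sum_card_residue_class:
  assumes "0 < Q"
  shows "(\<Sum>r<Q. card (residue_class N Q r)) = N"
proof -
  have "(\<Sum>r\<in>{..<Q}. \<Sum>n\<in>{n \<in> {1..N}. n mod Q = r}. 1) = (\<Sum>n=1..N. (1::nat))"
    by (rule sum.group) (use assms in auto)
  then show ?thesis by (simp add: residue_class_def)
qed

text \<open>The square expands into a double sum over pairs \<open>(m, n)\<close>. Congruent pairs
  (\<open>E\<close>) reassemble into the squares of the class sums. The other pairs with
  \<open>n < m\<close> (\<open>A\<close>) are sorted by \<open>h = m - n\<close>, and those with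
  \<open>m < n\<close> (\<open>B\<close>) give the complex conjugate. The triangle inequality is
  thus spent only on differences that \<open>Q\<close> does not divide.\<close>

lemma weyl_differencing:
  fixes z :: "nat \<Rightarrow> complex"
  assumes "0 < Q"
  shows "(cmod (\<Sum>n=1..N. z n))\<^sup>2 \<le> (\<Sum>r<Q. (cmod (\<Sum>n\<in>residue_class N Q r. z n))\<^sup>2)
    + 2 * (\<Sum>h | h \<in> {1..<N} \<and> \<not> Q dvd h. cmod (\<Sum>n=1..N-h. z (n + h) * cnj (z n)))"
proof -
  define P where "P = {1..N} \<times> {1..N}"
  define g where "g = (\<lambda>(m, n). z m * cnj (z n))"
  define E where "E = {(m, n) \<in> P. m mod Q = n mod Q}"
  define A where "A = {(m, n) \<in> P. n < m \<and> m mod Q \<noteq> n mod Q}"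
  define B where "B = {(m, n) \<in> P. m < n \<and> m mod Q \<noteq> n mod Q}"
  have fin: "finite P" "finite E" "finite A" "finite B"
    by (auto simp: P_def E_def A_def B_def intro: finite_subset[of _ "{1..N} \<times> {1..N}"])
  have "complex_of_real ((cmod (\<Sum>n=1..N. z n))\<^sup>2) = sum g P"
    unfolding complex_norm_square P_def g_def
    by (simp add: sum_product sum.cartesian_product)
  also have "P = (E \<union> A) \<union> B" 
  proof (intro equalityI subsetI)
    fix p assume p: "p \<in> P"
    obtain m n where mn: "p = (m, n)" by (cases p)
    consider "m mod Q = n mod Q" | "m mod Q \<noteq> n mod Q" "n < m" | "m mod Q \<noteq> n mod Q" "m < n"
      by (metis nat_neq_iff)
    then show "p \<in> (E \<union> A) \<union> B" by cases (use p mn in \<open>simp_all add: E_def A_def B_def\<close>)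
  qed (auto simp: E_def A_def B_def)
  also have "sum g \<dots> = sum g (E \<union> A) + sum g B"
    using fin by (intro sum.union_disjoint) (auto simp: E_def A_def B_def)
  also have "sum g (E \<union> A) = sum g E + sum g A"
    using fin by (intro sum.union_disjoint) (auto simp: E_def A_def)
  also have "sum g E = (\<Sum>r<Q. complex_of_real ((cmod (\<Sum>n\<in>residue_class N Q r. z n))\<^sup>2))"
  proof -
    have "sum g E = (\<Sum>r<Q. sum g {p \<in> E. fst p mod Q = r})"
      by (rule sum.group[symmetric]) (use fin assms in auto)
    also have "\<dots> = (\<Sum>r<Q. complex_of_real ((cmod (\<Sum>n\<in>residue_class N Q r. z n))\<^sup>2))"
    proof (rule sum.cong)
      fix r
      have "{p \<in> E. fst p mod Q = r} = residue_class N Q r \<times> residue_class N Q r"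
        by (auto simp: E_def P_def residue_class_def)
      then show "sum g {p \<in> E. fst p mod Q = r} = complex_of_real ((cmod (\<Sum>n\<in>residue_class N Q r. z n))\<^sup>2)"
        unfolding complex_norm_square g_def by (simp add: sum_product sum.cartesian_product)
    qed simp
    finally show ?thesis .
  qed
  also have "sum g B = cnj (sum g A)"
    unfolding cnj_sum
    by (rule sum.reindex_bij_witness[of _ prod.swap prod.swap]) (auto simp: A_def B_def P_def g_def)
  finally have "complex_of_real ((cmod (\<Sum>n=1..N. z n))\<^sup>2)
      = complex_of_real (\<Sum>r<Q. (cmod (\<Sum>n\<in>residue_class N Q r. z n))\<^sup>2) + sum g A + cnj (sum g A)"
    by simp
  from arg_cong[OF this, of Re]
  have "(cmod (\<Sum>n=1..N. z n))\<^sup>2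
      = (\<Sum>r<Q. (cmod (\<Sum>n\<in>residue_class N Q r. z n))\<^sup>2) + 2 * Re (sum g A)"
    by simp
  also have "Re (sum g A) \<le> cmod (sum g A)" by (rule complex_Re_le_cmod)
  also have "sum g A = (\<Sum>h | h \<in> {1..<N} \<and> \<not> Q dvd h. \<Sum>n=1..N-h. z (n + h) * cnj (z n))"
  proof -
    have dvd: "Q dvd m - n \<longleftrightarrow> m mod Q = n mod Q" if "n < m" for m n
      using that by (metis less_imp_le mod_eq_dvd_iff_nat)
    have "sum g A = (\<Sum>(h, n)\<in>(SIGMA h:{h. h \<in> {1..<N} \<and> \<not> Q dvd h}. {1..N-h}). z (n + h) * cnj (z n))"
    proof (rule sum.reindex_bij_witness[of _ "\<lambda>(h, n). (n + h, n)" "\<lambda>(m, n). (m - n, n)"])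
      fix p assume "p \<in> (SIGMA h:{h. h \<in> {1..<N} \<and> \<not> Q dvd h}. {1..N-h})"
      then obtain h n where p: "p = (h, n)" "h \<in> {1..<N}" "\<not> Q dvd h" "n \<in> {1..N-h}" by auto
      then show "(case p of (h, n) \<Rightarrow> (n + h, n)) \<in> A"
        using dvd[of n "n + h"] by (auto simp: A_def P_def)
    qed (auto simp: A_def P_def g_def dvd)
    then show ?thesis by (simp add: sum.Sigma)
  qed
  also have "cmod \<dots> \<le> (\<Sum>h | h \<in> {1..<N} \<and> \<not> Q dvd h. cmod (\<Sum>n=1..N-h. z (n + h) * cnj (z n)))"
    by (rule norm_sum)
  finally show ?thesis by simp
qed

section \<open>Sums of reciprocals of \<open>nu\<close> along multiples of a well approximated
  number\<close>

lemma harm_le_one_plus_ln: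
  assumes "1 \<le> n"
  shows "harm n \<le> 1 + ln (real n)"
proof -
  obtain m where m: "n = Suc m" using assms by (cases n) auto
  have "harm (Suc m) - ln (real (Suc m)) \<le> harm (Suc 0) - ln (real (Suc 0))"
    using decseqD[OF decseq_harm_diff_ln, of 0 m] by simp
  then show ?thesis by (simp add: m harm_def)
qed

text \<open>Modulo 1, \<open>h * s\<close> is \<open>j / q\<close> plus an error of at most
  \<open>1 / (2 * q)\<close>, because \<open>h < N\<close>. As \<open>j / q\<close> is at least
  \<open>1 / q\<close> away from 0 and from 1, the error costs at most half of either distance. The
  reciprocal of the smaller distance is then bounded by the sum of both reciprocals.\<close>

lemma nu_multiple_ge:
  fixes a :: int and q N h :: nat and s :: real
  assumes q: "0 < q" and s: "\<bar>of_nat q * s - of_int a\<bar> \<le> 1 / (2 * real N)" and h: "h \<in> {1..<N}"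
    and j: "j = nat ((int h * a) mod int q)" "j \<noteq> 0"
  shows "0 < nu (real h * s)" "1 / nu (real h * s) \<le> real q / real j + real q / (real q - real j)"
proof -
  define \<delta> where "\<delta> = real h * (q * s - a) / q"
  have jq: "1 \<le> j" "j < q" using j q by (simp_all add: nat_less_iff)
  have "int h * a = int q * (int h * a div int q) + int j"
    using q by (simp add: j(1))
  then have "real_of_int (int h * a) = real_of_int (int q * (int h * a div int q) + int j)" by (rule arg_cong)
  then have "real h * s = real_of_int (int h * a div int q) + (real j / real q + \<delta>)"
    using q by (simp add: \<delta>_def field_simps)
  then have nu_eq: "nu (real h * s) = nu (real j / real q + \<delta>)" by simp
  have "\<bar>\<delta>\<bar> \<le> real h * (1 / (2 * real N)) / real q"
    unfolding \<delta>_def abs_mult abs_divide abs_of_nat by (intro divide_right_mono mult_left_mono s) auto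
  also have "\<dots> \<le> 1 / (2 * real q)"
    using h q by (simp add: field_simps)
  finally have \<delta>: "\<bar>\<delta>\<bar> \<le> 1 / (2 * real q)" .
  have lo: "real j / real q + \<delta> \<ge> real j / (2 * real q)"
    and hi: "1 - (real j / real q + \<delta>) \<ge> (real q - real j) / (2 * real q)"
  proof -
    have "1 / (2 * real q) \<le> real j / (2 * real q)" using jq by (simp add: divide_right_mono)
    then show "real j / real q + \<delta> \<ge> real j / (2 * real q)" using \<delta> by (simp add: abs_le_iff)
    have "1 / (2 * real q) \<le> (real q - real j) / (2 * real q)" using jq by (intro divide_right_mono) auto
    moreover have "1 - real j / real q = 2 * ((real q - real j) / (2 * real q))" using q by (simp add: field_simps)
    ultimately show "1 - (real j / real q + \<delta>) \<ge> (real q - real j) / (2 * real q)" using \<delta> by linarith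
  qed
  have pos: "0 < real j / (2 * real q)" "0 < (real q - real j) / (2 * real q)" using jq by auto
  have ge: "min (real j / real q) ((real q - real j) / real q) \<le> nu (real h * s)"
  proof -
    have "min (2 * (real j / real q + \<delta>)) (2 * (1 - (real j / real q + \<delta>))) \<le> nu (real h * s)"
      unfolding nu_eq by (rule nu_ge) (use lo hi pos in linarith)+
    then show ?thesis using lo hi by (auto simp: min_def split: if_splits)
  qed
  moreover have mpos: "0 < min (real j / real q) ((real q - real j) / real q)" using jq by simp
  ultimately show "0 < nu (real h * s)" by linarith
  have "1 / nu (real h * s) \<le> 1 / min (real j / real q) ((real q - real j) / real q)"
    using ge mpos by (intro divide_left_mono mult_pos_pos) auto
  also have "\<dots> \<le> real q / real j + real q / (real q - real j)"
    using jq by (auto simp: min_def)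
  finally show "1 / nu (real h * s) \<le> real q / real j + real q / (real q - real j)" .
qed

text \<open>By coprimality, \<open>h * a\<close> modulo \<open>q\<close> determines \<open>h\<close>
  modulo \<open>q\<close>, so every nonzero residue \<open>j\<close> is taken at most
  \<open>N / q + 1\<close> times. What remains is a harmonic sum over \<open>j\<close>.\<close>

lemma sum_inverse_nu_le:
  fixes a :: int and q N :: nat and s :: real
  assumes q: "0 < q" and cop: "coprime a (int q)"
    and s: "\<bar>of_nat q * s - of_int a\<bar> \<le> 1 / (2 * real N)"
  shows "\<And>h. h \<in> {1..<N} \<Longrightarrow> \<not> q dvd h \<Longrightarrow> 0 < nu (real h * s)"
    and "(\<Sum>h | h \<in> {1..<N} \<and> \<not> q dvd h. 1 / nu (real h * s)) \<le> 2 * (real N + real q) * (1 + ln (real q))"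
proof -
  define H where "H = {h. h \<in> {1..<N} \<and> \<not> q dvd h}"
  define \<phi> where "\<phi> h = nat ((int h * a) mod int q)" for h :: nat
  define G where "G j = real q / real j + real q / (real q - real j)" for j
  have \<phi>: "\<phi> h \<in> {1..<q}" if "h \<in> H" for h
  proof -
    have "\<not> int q dvd int h * a"
      using that cop by (simp add: H_def coprime_dvd_mult_left_iff coprime_commute)
    then have "(int h * a) mod int q \<noteq> 0" by (simp only: dvd_eq_mod_eq_0 not_False_eq_True)
    moreover have "0 \<le> (int h * a) mod int q" "(int h * a) mod int q < int q" using q by simp_all
    ultimately have "0 < \<phi> h" "\<phi> h < q" unfolding \<phi>_def by linarith+
    then show ?thesis by simp
  qed
  show "0 < nu (real h * s)" if "h \<in> {1..<N}" "\<not> q dvd h" for h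
    using nu_multiple_ge(1)[OF q s that(1) \<phi>_def] \<phi>[of h] that by (simp add: H_def)
  have G_nonneg: "0 \<le> G j" if "j \<in> {1..<q}" for j using that by (simp add: G_def)
  have card_le: "real (card {h \<in> H. \<phi> h = j}) \<le> real N / real q + 1" for j
  proof (cases "{h \<in> H. \<phi> h = j} = {}")
    case False
    then obtain h0 where h0: "h0 \<in> H" "\<phi> h0 = j" by auto
    have "{h \<in> H. \<phi> h = j} \<subseteq> residue_class N q (h0 mod q)"
    proof
      fix h assume h: "h \<in> {h \<in> H. \<phi> h = j}"
      then have "(int h * a) mod int q = (int h0 * a) mod int q"
        using h0(2) q pos_mod_sign[of "int q" "int h * a"] pos_mod_sign[of "int q" "int h0 * a"] unfolding \<phi>_def by (auto simp: eq_nat_nat_iff simp del: pos_mod_sign)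
      then have "int q dvd (int h - int h0) * a" by (simp add: mod_eq_dvd_iff left_diff_distrib)
      then have "int q dvd int h - int h0" using cop by (simp add: coprime_dvd_mult_left_iff coprime_commute)
      then have "h mod q = h0 mod q" by (metis mod_eq_dvd_iff of_nat_eq_iff zmod_int)
      then show "h \<in> residue_class N q (h0 mod q)" using h by (auto simp: H_def residue_class_def)
    qed
    then have "card {h \<in> H. \<phi> h = j} \<le> card (residue_class N q (h0 mod q))"
      by (intro card_mono) auto
    then show ?thesis using card_residue_class_le[OF q, of N "h0 mod q"] by linarith
  next
    case True
    show ?thesis unfolding True by simp
  qed
  have "(\<Sum>h\<in>H. 1 / nu (real h * s)) \<le> (\<Sum>h\<in>H. G (\<phi> h))"
  proof (rule sum_mono)
    fix h assume "h \<in> H"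
    then show "1 / nu (real h * s) \<le> G (\<phi> h)"
      using nu_multiple_ge(2)[OF q s _ \<phi>_def, of h] \<phi>[of h] by (simp add: H_def G_def)
  qed
  also have "\<dots> = (\<Sum>j\<in>{1..<q}. \<Sum>h\<in>{h \<in> H. \<phi> h = j}. G (\<phi> h))"
    by (rule sum.group[symmetric]) (use \<phi> in \<open>auto simp: H_def\<close>)
  also have "\<dots> = (\<Sum>j\<in>{1..<q}. real (card {h \<in> H. \<phi> h = j}) * G j)" by simp
  also have "\<dots> \<le> (\<Sum>j\<in>{1..<q}. (real N / real q + 1) * G j)"
    by (intro sum_mono mult_right_mono card_le G_nonneg)
  also have "\<dots> = (real N / real q + 1) * (\<Sum>j\<in>{1..<q}. G j)" by (simp add: sum_distrib_left)
  \<comment> \<open>The reflection from \<open>j\<close> to \<open>q - j\<close> shows that both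
    summands of \<open>G\<close> contribute equally.\<close>
  also have "(\<Sum>j\<in>{1..<q}. G j) = 2 * real q * (\<Sum>j\<in>{1..<q}. 1 / real j)"
  proof -
    have "(\<Sum>j\<in>{1..<q}. real q / (real q - real j)) = (\<Sum>j\<in>{1..<q}. real q / real j)"
      by (rule sum.reindex_bij_witness[of _ "\<lambda>j. q - j" "\<lambda>j. q - j"]) (auto simp: of_nat_diff)
    then show ?thesis by (simp add: G_def sum.distrib sum_distrib_left)
  qed
  also have "(\<Sum>j\<in>{1..<q}. 1 / real j) \<le> harm q"
    unfolding harm_def by (subst inverse_eq_divide[symmetric], rule sum_mono2) auto
  also have "harm q \<le> 1 + ln (real q)" using q by (intro harm_le_one_plus_ln) simp
  also have "(real N / real q + 1) * (2 * real q * (1 + ln (real q))) = 2 * (real N + real q) * (1 + ln (real q))"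
    using q by (simp add: field_simps)
  finally show "(\<Sum>h | h \<in> {1..<N} \<and> \<not> q dvd h. 1 / nu (real h * s)) \<le> 2 * (real N + real q) * (1 + ln (real q))"
    using q by (simp add: H_def mult_left_mono)
qed

section \<open>Pointwise bounds for one Weyl sum\<close>

lemma weyl_sum_eq_e1: "weyl_sum N x t = (\<Sum>n=1..N. e1 (real n * x + (real n)\<^sup>2 * t))"
  unfolding weyl_sum_def e1_def cis_conv_exp by (intro sum.cong refl) (simp add: mult_ac)

text \<open>Up to the integer \<open>n * a\<close>, the phase \<open>f\<close> increases by \<open>\<theta> + (n + q / 2) * b\<close> from \<open>n\<close> to
  \<open>n + q\<close>.\<close>
context
  fixes N q :: nat and a :: int and x t b \<theta> :: real and f :: "nat \<Rightarrow> real"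
  assumes N: "1 \<le> N" and q: "0 < q" "q \<le> 2 * N" and cop: "coprime a (int q)"
  defines "b \<equiv> real q * (2 * t) - of_int a"
  defines "\<theta> \<equiv> real q * x + real q * of_int a / 2"
  defines "f \<equiv> \<lambda>n. real n * x + (real n)\<^sup>2 * t"
  assumes b: "\<bar>b\<bar> \<le> 1 / (2 * real N)"
begin

text \<open>Differencing makes the quadratic phase linear in \<open>n\<close>, with slope
  \<open>h * (2 * t)\<close>, so the correlation is a geometric sum.\<close>

lemma norm_correlation_le:
  "cmod (\<Sum>n=1..M. e1 (f (n + h)) * cnj (e1 (f n))) * nu (real h * (2 * t)) \<le> 1"
proof -
  have "e1 (f (n + h)) * cnj (e1 (f n)) = e1 ((real h * x + (real h)\<^sup>2 * t) + real n * (real h * (2 * t)))" for n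
    unfolding cnj_e1 e1_add[symmetric]
    by (rule arg_cong[of _ _ e1]) (simp add: f_def power2_eq_square algebra_simps)
  then show ?thesis by (simp only: norm_geometric_e1)
qed

lemma norm_correlation_le_inverse:
  "0 < nu (real h * (2 * t)) \<Longrightarrow>
    cmod (\<Sum>n=1..M. e1 (f (n + h)) * cnj (e1 (f n))) \<le> 1 / nu (real h * (2 * t))"
  using norm_correlation_le[of h M] by (simp add: pos_le_divide_eq)

lemma off_diagonal_le:
  "(\<Sum>h | h \<in> {1..<N} \<and> \<not> q dvd h. 1 / nu (real h * (2 * t))) \<le> 6 * real N * (1 + ln (2 * real N))"
proof -
  have "(\<Sum>h | h \<in> {1..<N} \<and> \<not> q dvd h. 1 / nu (real h * (2 * t)))
      \<le> 2 * (real N + real q) * (1 + ln (real q))"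
    using sum_inverse_nu_le(2)[OF q(1) cop, of "2 * t" N] b by (simp add: b_def)
  also have "\<dots> \<le> (6 * real N) * (1 + ln (2 * real N))"
  proof (rule mult_mono)
    show "1 + ln (real q) \<le> 1 + ln (2 * real N)" "0 \<le> 1 + ln (real q)"
      using q ln_ge_zero[of "real q"] by simp_all
  qed (use q in simp_all)
  finally show ?thesis .
qed

lemma off_diagonal_pos:
  "h \<in> {1..<N} \<Longrightarrow> \<not> q dvd h \<Longrightarrow> 0 < nu (real h * (2 * t))"
  using sum_inverse_nu_le(1)[OF q(1) cop, of "2 * t" N h] b by (simp add: b_def)

lemma norm_weyl_sum_square_le:
  "(cmod (weyl_sum N x t))\<^sup>2
    \<le> (\<Sum>r<q. (cmod (\<Sum>n\<in>residue_class N q r. e1 (f n)))\<^sup>2) + 12 * real N * (1 + ln (2 * real N))"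
proof -
  have "(\<Sum>h | h \<in> {1..<N} \<and> \<not> q dvd h. cmod (\<Sum>n=1..N-h. e1 (f (n + h)) * cnj (e1 (f n))))
      \<le> (\<Sum>h | h \<in> {1..<N} \<and> \<not> q dvd h. 1 / nu (real h * (2 * t)))"
    by (intro sum_mono norm_correlation_le_inverse off_diagonal_pos) auto
  then show ?thesis
    using weyl_differencing[OF q(1), where N = N and z = "\<lambda>n. e1 (f n)"] off_diagonal_le
    unfolding weyl_sum_eq_e1 f_def by linarith
qed

lemma norm_class_sum_le: "cmod (\<Sum>n\<in>residue_class N Q r. e1 (f n)) \<le> real (card (residue_class N Q r))"
  using sum_norm_le[of "residue_class N Q r" "\<lambda>n. e1 (f n)" "\<lambda>_. 1"] by simp

text \<open>In each square one factor is bounded by the largest possible class size, while the other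
  factors add up to \<open>N\<close>. The modulus is left free because both \<open>q\<close> and
  \<open>N\<close> are used for it.\<close>

lemma sum_class_sums_le:
  assumes Q: "0 < Q"
  shows "(\<Sum>r<Q. (cmod (\<Sum>n\<in>residue_class N Q r. e1 (f n)))\<^sup>2) \<le> (real N / real Q + 1) * real N"
proof -
  have "(cmod (\<Sum>n\<in>residue_class N Q r. e1 (f n)))\<^sup>2 \<le> (real N / real Q + 1) * real (card (residue_class N Q r))" for r
    unfolding power2_eq_square
    by (intro mult_mono order_trans[OF norm_class_sum_le card_residue_class_le] norm_class_sum_le Q) auto
  then have "(\<Sum>r<Q. (cmod (\<Sum>n\<in>residue_class N Q r. e1 (f n)))\<^sup>2)
      \<le> (\<Sum>r<Q. (real N / real Q + 1) * real (card (residue_class N Q r)))" by (rule sum_mono)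
  also have "\<dots> = (real N / real Q + 1) * real N"
    unfolding sum_distrib_left[symmetric] of_nat_sum[symmetric] sum_card_residue_class[OF Q] ..
  finally show ?thesis .
qed

text \<open>With trivial bounds on the class sums, the terms besides \<open>N\<^sup>2 / q\<close>
  have size \<open>N\<close> up to a logarithm. They are absorbed because
  \<open>q \<le> 2 * N\<close> gives \<open>N \<le> 2 * N\<^sup>2 / q\<close>.\<close>

lemma weyl_sum_square_le:
  "(cmod (weyl_sum N x t))\<^sup>2 \<le> 27 * (1 + ln (2 * real N)) * (real N)\<^sup>2 / real q"
proof -
  define \<Lambda> where "\<Lambda> = 1 + ln (2 * real N)"
  have L: "1 \<le> \<Lambda>" using N by (simp add: \<Lambda>_def ln_ge_zero)
  have "(cmod (weyl_sum N x t))\<^sup>2 \<le> (real N / real q + 1) * real N + 12 * real N * \<Lambda>"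
    using norm_weyl_sum_square_le sum_class_sums_le[OF q(1)] by (simp add: \<Lambda>_def)
  also have "\<dots> = (real N)\<^sup>2 / real q + real N * (1 + 12 * \<Lambda>)" by (simp add: power2_eq_square algebra_simps)
  also have "\<dots> \<le> (real N)\<^sup>2 / real q + (2 * (real N)\<^sup>2 / real q) * (1 + 12 * \<Lambda>)"
  proof -
    have "real N * real q \<le> real N * (2 * real N)" using q by (intro mult_left_mono) auto
    then have "real N \<le> 2 * (real N)\<^sup>2 / real q" using q(1) by (simp add: field_simps power2_eq_square)
    then show ?thesis using L by (intro add_left_mono mult_right_mono) auto
  qed
  also have "\<dots> = (3 + 24 * \<Lambda>) * (real N)\<^sup>2 / real q" by (simp add: algebra_simps add_divide_distrib)
  also have "\<dots> \<le> (27 * \<Lambda>) * (real N)\<^sup>2 / real q"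
    using L by (intro divide_right_mono mult_right_mono) auto
  finally show ?thesis by (simp add: \<Lambda>_def)
qed

text \<open>The hypothesis says that the drift \<open>(n + q / 2) * b\<close> of the increments
  changes \<open>nu\<close> by at most \<open>nu \<theta> / 2\<close>. Half of
  \<open>nu \<theta>\<close> survives, and the factor 2 in \<open>norm_one_minus_e1\<close> restores
  it. The same hypothesis bounds the total variation of the increments along the class.\<close>

lemma class_sum_le_far:
  assumes far: "2 * pi * real N * \<bar>b\<bar> \<le> nu \<theta>" and pos: "0 < nu \<theta>"
  shows "cmod (\<Sum>n\<in>residue_class N q r. e1 (f n)) \<le> 4 / nu \<theta>"
proof (cases "residue_class N q r = {}")
  case True
  then show ?thesis by simp
next
  case False
  then obtain k D where kD: "1 \<le> k" "k + q * D \<le> N" "residue_class N q r = (\<lambda>m. k + q * m) ` {..D}"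
    using residue_class_progression q(1) by metis
  define n where "n m = k + q * m" for m
  define w where "w m = e1 (f (n (Suc m)) - f (n m))" for m
  have incr: "f (n (Suc m)) - f (n m) = (\<theta> + (real (n m) + real q / 2) * b) + of_int (int (n m) * a)" for m
    by (simp add: f_def n_def \<theta>_def b_def power2_eq_square field_simps)
  have w: "w m = e1 (\<theta> + (real (n m) + real q / 2) * b)" for m
    unfolding w_def incr e1_add
    by (simp add: e1_def cis_multiple_2pi mult.commute[of _ "2 * pi"])
  have inj: "inj_on (\<lambda>m. k + q * m) {..D}" using q(1) by (auto intro: inj_onI)
  have "(\<Sum>m\<in>residue_class N q r. e1 (f m)) = (\<Sum>m\<le>D. e1 (f (n m)))"
    unfolding kD(3) sum.reindex[OF inj] by (simp add: n_def)
  also have "cmod \<dots> \<le> 4 / nu \<theta>"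
  proof (rule kuzmin_landau[where w = w and \<eta> = "2 * pi * (real q * \<bar>b\<bar>)"])
    show "e1 (f (n (Suc m))) = e1 (f (n m)) * w m" for m
      by (simp add: w_def flip: e1_add)
    show "nu \<theta> \<le> cmod (1 - w m)" if "m < D" for m
    proof -
      \<comment> \<open>Both ends \<open>n m\<close> and \<open>n m + q\<close> of the increment lie
        in \<open>{1..N}\<close>, hence so does the bound on their midpoint
        \<open>n m + q / 2\<close>.\<close>
      have "q * Suc m \<le> q * D" using that by (intro mult_le_mono) auto
      then have "n m + q \<le> N" using kD(2) by (simp add: n_def)
      then have "real (n m) + real q / 2 \<le> real N" by linarith
      then have "\<bar>(real (n m) + real q / 2) * b\<bar> \<le> real N * \<bar>b\<bar>"
        by (simp add: abs_mult mult_right_mono)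
      then have "pi * \<bar>(real (n m) + real q / 2) * b\<bar> \<le> pi * (real N * \<bar>b\<bar>)"
          by (rule mult_left_mono) simp
      then have "nu ((real (n m) + real q / 2) * b) \<le> nu \<theta> / 2"
        using nu_le_pi_abs[of "(real (n m) + real q / 2) * b"] far by linarith
      moreover have "nu \<theta> \<le> nu (\<theta> + (real (n m) + real q / 2) * b) + nu (- ((real (n m) + real q / 2) * b))"
        using nu_add_le[of "\<theta> + (real (n m) + real q / 2) * b" "- ((real (n m) + real q / 2) * b)"] by simp
      ultimately show ?thesis unfolding w norm_one_minus_e1 by simp
    qed
    show "cmod (w (Suc m) - w m) \<le> 2 * pi * (real q * \<bar>b\<bar>)" for m
    proof -
      have "(\<theta> + (real (n (Suc m)) + real q / 2) * b) - (\<theta> + (real (n m) + real q / 2) * b) = real q * b"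
        by (simp add: n_def algebra_simps)
      then show ?thesis
        using norm_e1_diff_le[of "\<theta> + (real (n (Suc m)) + real q / 2) * b" "\<theta> + (real (n m) + real q / 2) * b"]
        unfolding w by (simp add: abs_mult)
    qed
    have "real (D * q) \<le> real N" using kD(2) by (simp only: of_nat_le_iff) (simp add: mult.commute)
    then have "(real D * real q) * (2 * pi * \<bar>b\<bar>) \<le> real N * (2 * pi * \<bar>b\<bar>)"
      by (intro mult_right_mono) auto
    then show "real D * (2 * pi * (real q * \<bar>b\<bar>)) \<le> nu \<theta>" using far by (simp only: mult_ac)
  qed (use pos nu_le_one in auto)
  finally show ?thesis .
qed

text \<open>Within a residue class the phase increments stay away from the integers.\<close>
lemma weyl_sum_le_far:
  assumes far: "2 * pi * real N * \<bar>b\<bar> \<le> nu \<theta>"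
  shows "(cmod (weyl_sum N x t))\<^sup>2 * nu \<theta> \<le> 25 * real N * (1 + ln (2 * real N))"
proof (cases "nu \<theta> = 0")
  case True
  then show ?thesis using N by (simp add: ln_ge_zero)
next
  case False
  then have pos: "0 < nu \<theta>" using nu_nonneg[of \<theta>] by linarith
  define \<Lambda> where "\<Lambda> = 1 + ln (2 * real N)"
  have L: "1 \<le> \<Lambda>" using N by (simp add: \<Lambda>_def ln_ge_zero)
  have "(cmod (\<Sum>n\<in>residue_class N q r. e1 (f n)))\<^sup>2 \<le> 4 / nu \<theta> * real (card (residue_class N q r))" for r
    unfolding power2_eq_square using pos
    by (intro mult_mono class_sum_le_far far norm_class_sum_le) auto
  then have "(\<Sum>r<q. (cmod (\<Sum>n\<in>residue_class N q r. e1 (f n)))\<^sup>2)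
      \<le> (\<Sum>r<q. 4 / nu \<theta> * real (card (residue_class N q r)))" by (rule sum_mono)
  also have "\<dots> = 4 / nu \<theta> * real N"
    unfolding sum_distrib_left[symmetric] of_nat_sum[symmetric] sum_card_residue_class[OF q(1)] ..
  finally have "(cmod (weyl_sum N x t))\<^sup>2 \<le> 4 / nu \<theta> * real N + 12 * real N * \<Lambda>"
    using norm_weyl_sum_square_le by (simp add: \<Lambda>_def)
  then have "(cmod (weyl_sum N x t))\<^sup>2 * nu \<theta> \<le> (4 / nu \<theta> * real N + 12 * real N * \<Lambda>) * nu \<theta>"
    using pos by (intro mult_right_mono) auto
  also have "\<dots> = 4 * real N + 12 * real N * \<Lambda> * nu \<theta>" using pos by (simp add: field_simps)
  also have "\<dots> \<le> 4 * real N * \<Lambda> + 12 * real N * \<Lambda> * 1"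
    using L nu_le_one by (intro add_mono mult_left_mono) (simp_all add: mult_le_cancel_left1)
  also have "\<dots> \<le> 25 * real N * \<Lambda>" using L by simp
  finally show ?thesis by (simp add: \<Lambda>_def)
qed

text \<open>Here \<open>b\<close> is not too small, and differencing all of \<open>{1..N}\<close> at once already suffices: this is
  the case \<open>Q = N\<close> of the differencing inequality, in which the residue classes are singletons.\<close>
lemma weyl_sum_le_near:
  assumes near: "nu \<theta> < 2 * pi * real N * \<bar>b\<bar>"
  shows "(cmod (weyl_sum N x t))\<^sup>2 * nu \<theta> \<le> 25 * real N * (1 + ln (2 * real N))"
proof -
  define \<Lambda> where "\<Lambda> = 1 + ln (2 * real N)"
  have L: "1 \<le> \<Lambda>" using N by (simp add: \<Lambda>_def ln_ge_zero)
  have b_pos: "0 < \<bar>b\<bar>" using near nu_nonneg[of \<theta>] by (cases "b = 0") auto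
  define c where "c h = cmod (\<Sum>n=1..N-h. e1 (f (n + h)) * cnj (e1 (f n)))" for h
  have c_mult: "c (q * k) \<le> 1 / (2 * real k * \<bar>b\<bar>)" if "q * k \<in> {1..<N}" for k
  proof -
    have k: "0 < k" "k \<le> N"
    proof -
      show "0 < k" using that by (cases k) auto
      have "1 * k \<le> q * k" using q(1) by (intro mult_le_mono) auto
      then show "k \<le> N" using that unfolding atLeastLessThan_iff by linarith
    qed
    \<comment> \<open>For the multiple \<open>q * k\<close> the slope is \<open>k * b\<close> modulo
      1. Since \<open>k \<le> N\<close> forces \<open>k * \<bar>b\<bar> \<le> 1 / 2\<close>, there
      is no wrap-around and \<open>nu\<close> is at least
      \<open>2 * k * \<bar>b\<bar>\<close>.\<close>
    have "real (q * k) * (2 * t) = real k * b + of_int (int k * a)"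
      by (simp add: b_def algebra_simps)
    then have "nu (real (q * k) * (2 * t)) = nu (real k * b)" by (simp only: nu_add_int)
    also have "\<dots> = nu (real k * \<bar>b\<bar>)" by (cases "0 \<le> b") (simp_all add: abs_if)
    also have "\<dots> \<ge> 2 * (real k * \<bar>b\<bar>)"
    proof -
      have "real k * \<bar>b\<bar> \<le> real N * (1 / (2 * real N))" using b k by (intro mult_mono) auto
      then have "real k * \<bar>b\<bar> \<le> 1 / 2" using N by simp
      then show ?thesis using nu_ge[of "real k * \<bar>b\<bar>"] by (simp add: min_def split: if_splits)
    qed
    finally have ge: "2 * (real k * \<bar>b\<bar>) \<le> nu (real (q * k) * (2 * t))" .
    moreover have pos: "0 < 2 * (real k * \<bar>b\<bar>)" using k b_pos by simp
    ultimately have "c (q * k) \<le> 1 / nu (real (q * k) * (2 * t))"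
      unfolding c_def by (intro norm_correlation_le_inverse) linarith
    also have "\<dots> \<le> 1 / (2 * (real k * \<bar>b\<bar>))"
      by (rule divide_left_mono[OF ge _ mult_pos_pos[OF order.strict_trans2[OF pos ge] pos]]) simp
    finally show ?thesis by (simp add: mult_ac)
  qed
  have "(cmod (weyl_sum N x t))\<^sup>2 \<le> (\<Sum>r<N. (cmod (\<Sum>n\<in>residue_class N N r. e1 (f n)))\<^sup>2)
      + 2 * (\<Sum>h | h \<in> {1..<N} \<and> \<not> N dvd h. c h)"
    using weyl_differencing[where Q = N and N = N and z = "\<lambda>n. e1 (f n)"] N unfolding weyl_sum_eq_e1 f_def c_def by simp
  moreover have "(\<Sum>r<N. (cmod (\<Sum>n\<in>residue_class N N r. e1 (f n)))\<^sup>2) \<le> 2 * real N"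
    using sum_class_sums_le[of N] N by simp
  moreover have "{h \<in> {1..<N}. \<not> N dvd h} = {1..<N}" by (auto dest: dvd_imp_le)
  moreover have "sum c {1..<N} = sum c {h. h \<in> {1..<N} \<and> \<not> q dvd h} + sum c {h. h \<in> {1..<N} \<and> q dvd h}"
    by (subst sum.union_disjoint[symmetric]) (auto intro!: sum.cong)
  moreover have "sum c {h. h \<in> {1..<N} \<and> \<not> q dvd h} \<le> 6 * real N * \<Lambda>"
    unfolding \<Lambda>_def
  proof (rule order_trans[OF sum_mono off_diagonal_le])
    fix h assume "h \<in> {h. h \<in> {1..<N} \<and> \<not> q dvd h}"
    then show "c h \<le> 1 / nu (real h * (2 * t))"
      unfolding c_def by (intro norm_correlation_le_inverse off_diagonal_pos) auto
  qed
  moreover have "sum c {h. h \<in> {1..<N} \<and> q dvd h} \<le> \<Lambda> / (2 * \<bar>b\<bar>)"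
  proof -
    have "sum c {h. h \<in> {1..<N} \<and> q dvd h} = (\<Sum>k | q * k \<in> {1..<N}. c (q * k))"
      by (rule sum.reindex_bij_witness[of _ "\<lambda>k. q * k" "\<lambda>h. h div q"]) (use q(1) in auto)
    also have "\<dots> \<le> (\<Sum>k | q * k \<in> {1..<N}. 1 / (2 * real k * \<bar>b\<bar>))"
      by (intro sum_mono c_mult) auto
    also have "\<dots> \<le> (\<Sum>k\<in>{1..N}. 1 / (2 * real k * \<bar>b\<bar>))"
    proof (rule sum_mono2)
      show "{k. q * k \<in> {1..<N}} \<subseteq> {1..N}"
      proof
        fix k assume k: "k \<in> {k. q * k \<in> {1..<N}}"
        have "1 * k \<le> q * k" using q(1) by (intro mult_le_mono) auto
        then show "k \<in> {1..N}" using k by (cases k) auto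
      qed
    qed auto
    also have "\<dots> = harm N / (2 * \<bar>b\<bar>)"
      unfolding harm_def sum_divide_distrib by (intro sum.cong) (auto simp: field_simps)
    also have "\<dots> \<le> (1 + ln (real N)) / (2 * \<bar>b\<bar>)"
      using harm_le_one_plus_ln[OF N] by (intro divide_right_mono) auto
    also have "\<dots> \<le> \<Lambda> / (2 * \<bar>b\<bar>)" using N unfolding \<Lambda>_def by (intro divide_right_mono) auto
    finally show ?thesis .
  qed
  ultimately have "(cmod (weyl_sum N x t))\<^sup>2 \<le> 2 * real N + 12 * real N * \<Lambda> + \<Lambda> / \<bar>b\<bar>" by simp
  then have "(cmod (weyl_sum N x t))\<^sup>2 * nu \<theta> \<le> (2 * real N + 12 * real N * \<Lambda> + \<Lambda> / \<bar>b\<bar>) * nu \<theta>"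
    by (intro mult_right_mono) auto
  also have "\<dots> = (2 * real N + 12 * real N * \<Lambda>) * nu \<theta> + \<Lambda> / \<bar>b\<bar> * nu \<theta>" by (simp add: algebra_simps)
  \<comment> \<open>The multiples of \<open>q\<close> cost \<open>\<Lambda> / \<bar>b\<bar>\<close>,
    which is large for small \<open>b\<close>. Assumption \<open>near\<close> compensates exactly,
    since \<open>nu \<theta>\<close> is then below a multiple of
    \<open>N * \<bar>b\<bar>\<close>.\<close>
  also have "\<dots> \<le> (2 * real N * \<Lambda> + 12 * real N * \<Lambda>) * 1 + \<Lambda> / \<bar>b\<bar> * (2 * pi * real N * \<bar>b\<bar>)"
  proof (rule add_mono)
    have "real N \<le> real N * \<Lambda>" using L by (simp add: mult_le_cancel_left1)
    then have "2 * real N + 12 * real N * \<Lambda> \<le> 2 * real N * \<Lambda> + 12 * real N * \<Lambda>" by linarith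
    then show "(2 * real N + 12 * real N * \<Lambda>) * nu \<theta> \<le> (2 * real N * \<Lambda> + 12 * real N * \<Lambda>) * 1"
      by (rule mult_mono[OF _ nu_le_one]) (use L in simp_all)
    show "\<Lambda> / \<bar>b\<bar> * nu \<theta> \<le> \<Lambda> / \<bar>b\<bar> * (2 * pi * real N * \<bar>b\<bar>)"
      using L near b_pos by (intro mult_left_mono) auto
  qed
  also have "\<dots> = (14 + 2 * pi) * (real N * \<Lambda>)" using b_pos by (simp add: algebra_simps)
  also have "\<dots> \<le> 25 * (real N * \<Lambda>)" using L pi_less_4 by (intro mult_right_mono) auto
  finally show ?thesis by (simp add: \<Lambda>_def mult_ac)
qed

text \<open>The term \<open>q * a / 2\<close> in \<open>\<theta>\<close> may be a half-integer.
  Doubling makes it integral, which removes the dependence on \<open>a\<close> at the price of a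
  factor 2 and of the frequency \<open>2 * q\<close>.\<close>

lemma weyl_sum_nu_le:
  "(cmod (weyl_sum N x t))\<^sup>2 * nu (real (2 * q) * x) \<le> 50 * real N * (1 + ln (2 * real N))"
proof -
  have "2 * \<theta> = real (2 * q) * x + of_int (int q * a)" by (simp add: \<theta>_def algebra_simps)
  then have "nu (real (2 * q) * x) = nu (2 * \<theta>)" by (simp only: nu_add_int)
  also have "\<dots> \<le> 2 * nu \<theta>" by (rule nu_double_le)
  finally have "(cmod (weyl_sum N x t))\<^sup>2 * nu (real (2 * q) * x) \<le> (cmod (weyl_sum N x t))\<^sup>2 * (2 * nu \<theta>)"
    by (intro mult_left_mono) auto
  then show ?thesis using weyl_sum_le_far weyl_sum_le_near by (cases "2 * pi * real N * \<bar>b\<bar> \<le> nu \<theta>") auto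
qed

end

text \<open>Only \<open>2 * t\<close> is approximated, so the same \<open>q\<close> serves every
  \<open>x\<close>. The summand \<open>1 / N\<close> in the last bound stems from the first bound
  with \<open>q \<ge> 1\<close>, and keeps the right-hand side finite where \<open>nu\<close>
  vanishes.\<close>

lemma weyl_sum_uniform_bound:
  fixes N :: nat and t :: real
  assumes N: "1 \<le> N"
  obtains q where "q \<in> {1..2 * N}"
    "\<And>x. (cmod (weyl_sum N x t))\<^sup>2 \<le> 50 * (1 + ln (2 * real N)) * ((real N)\<^sup>2 / real q)"
    "\<And>x. (cmod (weyl_sum N x t))\<^sup>2 \<le> 100 * (1 + ln (2 * real N)) * (real N / (nu (real (2 * q) * x) + 1 / real N))"
proof -
  \<comment> \<open>Differencing produces multiples of \<open>2 * t\<close>. Denominators up to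
    \<open>2 * N\<close> leave an error below \<open>1 / (2 * N)\<close>, as the lemmas on multiples
    \<open>h < N\<close> require.\<close>
  obtain a k where ak: "coprime a k" "0 < k" "k \<le> int (2 * N)"
      "\<bar>of_int k * (2 * t) - of_int a\<bar> < 1 / real (2 * N)"
    using Dirichlet_approx_coprime[of "2 * N" "2 * t"] N by auto
  define q where "q = nat k"
  have k: "k = int q" using ak by (simp add: q_def)
  have q: "0 < q" "q \<le> 2 * N" "coprime a (int q)" using ak by (auto simp: k)
  have b: "\<bar>real q * (2 * t) - of_int a\<bar> \<le> 1 / (2 * real N)" using ak(4) by (simp add: k)
  define \<Lambda> where "\<Lambda> = 1 + ln (2 * real N)"
  have L: "1 \<le> \<Lambda>" using N by (simp add: \<Lambda>_def ln_ge_zero)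
  show ?thesis
  proof (rule that[of q])
    show "q \<in> {1..2 * N}" using q by auto
    fix x
    have minor: "(cmod (weyl_sum N x t))\<^sup>2 \<le> 27 * \<Lambda> * (real N)\<^sup>2 / real q"
      unfolding \<Lambda>_def by (rule weyl_sum_square_le[OF N q b])
    also have "\<dots> \<le> 50 * \<Lambda> * (real N)\<^sup>2 / real q"
      using L by (intro divide_right_mono mult_right_mono) auto
    finally show "(cmod (weyl_sum N x t))\<^sup>2 \<le> 50 * (1 + ln (2 * real N)) * ((real N)\<^sup>2 / real q)"
      by (simp add: \<Lambda>_def)
    have "27 * \<Lambda> * (real N)\<^sup>2 / real q \<le> 27 * \<Lambda> * (real N)\<^sup>2 / 1"
      using q L by (intro divide_left_mono) auto
    with minor have "(cmod (weyl_sum N x t))\<^sup>2 * (1 / real N) \<le> (27 * \<Lambda> * (real N)\<^sup>2) * (1 / real N)"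
      by (intro mult_right_mono) auto
    also have "\<dots> = 27 * real N * \<Lambda>" using N by (simp add: power2_eq_square)
    finally have "(cmod (weyl_sum N x t))\<^sup>2 * (nu (real (2 * q) * x) + 1 / real N) \<le> 50 * real N * \<Lambda> + 27 * real N * \<Lambda>"
      using weyl_sum_nu_le[OF N q b, of x] unfolding \<Lambda>_def ring_distribs(1) by linarith
    also have "\<dots> \<le> 100 * \<Lambda> * real N" using L by simp
    finally have "(cmod (weyl_sum N x t))\<^sup>2 * (nu (real (2 * q) * x) + 1 / real N) \<le> 100 * \<Lambda> * real N" .
    moreover have "0 < nu (real (2 * q) * x) + 1 / real N" using N by (intro add_nonneg_pos) auto
    ultimately show "(cmod (weyl_sum N x t))\<^sup>2 \<le> 100 * (1 + ln (2 * real N)) * (real N / (nu (real (2 * q) * x) + 1 / real N))"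
      by (simp add: \<Lambda>_def pos_le_divide_eq)
  qed
qed

section \<open>Integration over the torus\<close>

text \<open>The integral over \<open>{0..<M}\<close> is computed twice, by cutting it into
  \<open>M\<close> periods and by the substitution with factor \<open>M\<close>.\<close>

lemma nn_integral_periodic_dilation:
  fixes F :: "real \<Rightarrow> ennreal"
  assumes [measurable]: "F \<in> borel_measurable borel" and periodic: "\<And>y. F (y + 1) = F y"
    and M: "1 \<le> (M::nat)"
  shows "(\<integral>\<^sup>+x. F (real M * x) * indicator {0..<1} x \<partial>lborel) = (\<integral>\<^sup>+x. F x * indicator {0..<1} x \<partial>lborel)"
    (is "?L = ?R")
proof -
  have period: "F (real k + x) = F x" for k x
  proof (induction k)
    case (Suc k)
    then show ?case using periodic[of "real k + x"] by (simp add: ac_simps)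
  qed simp
  have unit: "(\<integral>\<^sup>+x. F x * indicator {real k..<real k + 1} x \<partial>lborel) = ?R" for k
  proof -
    have "(\<integral>\<^sup>+x. F x * indicator {real k..<real k + 1} x \<partial>lborel)
        = (\<integral>\<^sup>+x. F (real k + 1 * x) * indicator {real k..<real k + 1} (real k + 1 * x) \<partial>lborel)"
      by (subst nn_integral_real_affine[where c = 1 and t = "real k"]) auto
    also have "\<dots> = ?R"
      by (intro nn_integral_cong) (auto simp: period indicator_def)
    finally show ?thesis .
  qed
  have "(\<integral>\<^sup>+x. F x * indicator {0..<real k} x \<partial>lborel) = of_nat k * ?R" for k
  proof (induction k)
    case (Suc k)
    have "(\<integral>\<^sup>+x. F x * indicator {0..<real (Suc k)} x \<partial>lborel)
        = (\<integral>\<^sup>+x. F x * indicator {0..<real k} x + F x * indicator {real k..<real k + 1} x \<partial>lborel)"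
      by (intro nn_integral_cong) (auto simp: indicator_def)
    also have "\<dots> = of_nat k * ?R + ?R"
      by (subst nn_integral_add) (auto simp: Suc unit)
    finally show ?case by (simp add: algebra_simps)
  qed simp
  moreover have "(\<integral>\<^sup>+x. F x * indicator {0..<real M} x \<partial>lborel) = of_nat M * ?L"
  proof -
    have "(\<integral>\<^sup>+x. F x * indicator {0..<real M} x \<partial>lborel)
        = ennreal \<bar>real M\<bar> * (\<integral>\<^sup>+x. F (0 + real M * x) * indicator {0..<real M} (0 + real M * x) \<partial>lborel)"
      using M by (intro nn_integral_real_affine) auto
    also have "(\<integral>\<^sup>+x. F (0 + real M * x) * indicator {0..<real M} (0 + real M * x) \<partial>lborel) = ?L"
      using M by (intro nn_integral_cong) (auto simp: indicator_def zero_le_mult_iff)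
    finally show ?thesis by (simp add: ennreal_of_nat_eq_real_of_nat)
  qed
  ultimately have "of_nat M * ?L = of_nat M * ?R" by simp
  then show ?thesis using M by (simp add: ennreal_mult_cancel_left)
qed

lemma measurable_nu [measurable]: "nu \<in> borel_measurable borel"
proof -
  have "continuous_on UNIV nu" unfolding nu_def by (intro continuous_intros)
  then show ?thesis by (rule borel_measurable_continuous_onI)
qed

text \<open>By \<open>nu_ge\<close> the integrand is at most one of two rational functions, hence at
  most their sum \<open>g\<close>. The primitive \<open>G\<close> of \<open>g\<close> gives the
  value \<open>ln (2 * N + 1)\<close>.\<close>

lemma nn_integral_inverse_nu_le:
  assumes N: "1 \<le> (N::nat)"
  shows "(\<integral>\<^sup>+y. ennreal (1 / (nu y + 1 / real N)) * indicator {0..<1} y \<partial>lborel) \<le> ennreal (1 + ln (2 * real N))"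
proof -
  define \<delta> where "\<delta> = 1 / real N"
  have \<delta>: "0 < \<delta>" using N by (simp add: \<delta>_def)
  define g where "g y = 1 / (2 * y + \<delta>) + 1 / (2 * (1 - y) + \<delta>)" for y
  define G where "G y = ln (2 * y + \<delta>) / 2 - ln (2 * (1 - y) + \<delta>) / 2" for y
  have "(\<integral>\<^sup>+y. ennreal (1 / (nu y + \<delta>)) * indicator {0..<1} y \<partial>lborel)
      \<le> (\<integral>\<^sup>+y. ennreal (g y) * indicator {0..1} y \<partial>lborel)"
  proof (intro nn_integral_mono)
    fix y :: real
    show "ennreal (1 / (nu y + \<delta>)) * indicator {0..<1} y \<le> ennreal (g y) * indicator {0..1} y"
    proof (cases "y \<in> {0..<1}")
      case True
      then have y: "0 \<le> y" "y \<le> 1" by auto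
      have pos: "0 < 1 / (2 * y + \<delta>)" "0 < 1 / (2 * (1 - y) + \<delta>)" using y \<delta> by auto
      have "1 / (nu y + \<delta>) \<le> 1 / (min (2 * y) (2 * (1 - y)) + \<delta>)"
        using nu_ge[OF y] y \<delta> by (intro divide_left_mono mult_pos_pos add_nonneg_pos) auto
      also have "\<dots> \<le> g y" using pos by (simp add: g_def min_def)
      finally show ?thesis using True by (simp add: ennreal_leI)
    qed simp
  qed
  also have "\<dots> = ennreal (G 1 - G 0)"
  proof (rule nn_integral_FTC_Icc)
    show "g \<in> borel_measurable borel" unfolding g_def by measurable
    fix y :: real assume y: "y \<in> {0..1}"
    then have "0 < 2 * y + \<delta>" "0 < 2 * (1 - y) + \<delta>" using \<delta> by auto
    moreover from this have "((\<lambda>y. ln (2 * y + \<delta>) / 2) has_real_derivative 1 / (2 * y + \<delta>)) (at y)"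
      by (auto intro!: derivative_eq_intros simp: frac_eq_eq)
    moreover from calculation
    have "((\<lambda>y. ln (2 * (1 - y) + \<delta>) / 2) has_real_derivative - 1 / (2 * (1 - y) + \<delta>)) (at y)"
      by (auto intro!: derivative_eq_intros simp: frac_eq_eq)
    ultimately show "(G has_real_derivative g y) (at y)" "0 \<le> g y"
      unfolding G_def g_def
      by (auto dest: DERIV_diff)
  qed simp
  also have "G 1 - G 0 = ln ((2 + \<delta>) / \<delta>)"
    using \<delta> by (simp add: G_def ln_div)
  also have "(2 + \<delta>) / \<delta> = 2 * real N + 1" using N by (simp add: \<delta>_def field_simps)
  also have "ln (2 * real N + 1) \<le> 1 + ln (2 * real N)"
  proof -
    have "ln (2 * real N + 1) = ln (2 * real N * (1 + 1 / (2 * real N)))"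
      using N by (simp add: distrib_left)
    also have "\<dots> = ln (2 * real N) + ln (1 + 1 / (2 * real N))"
      using N by (intro ln_mult_pos add_pos_pos) auto
    also have "ln (1 + 1 / (2 * real N)) \<le> 1 / (2 * real N)"
      using N by (intro ln_add_one_self_le_self) auto
    also have "1 / (2 * real N) \<le> 1" using N by simp
    finally show ?thesis by simp
  qed
  finally show ?thesis by (simp add: \<delta>_def ennreal_leI)
qed

lemma nn_integral_torus_prod:
  assumes [measurable]: "g \<in> borel_measurable borel"
  shows "(\<integral>\<^sup>+x. (\<Prod>j=1..d. g (x j)) \<partial>torus d) = (\<integral>\<^sup>+y. g y * indicator {0..<1} y \<partial>lborel) ^ d"
proof -
  interpret finite_measure "restrict_space lborel {0..<1::real}"
    by (rule finite_measureI) (simp add: emeasure_restrict_space)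
  interpret product_sigma_finite "\<lambda>_::nat. restrict_space lborel {0..<1::real}" ..
  have "(\<integral>\<^sup>+x. (\<Prod>j=1..d. g (x j)) \<partial>torus d) = (\<Prod>j=1..d. integral\<^sup>N (restrict_space lborel {0..<1}) g)"
    unfolding torus_def by (rule product_nn_integral_prod) (auto intro!: measurable_restrict_space1)
  then show ?thesis by (simp add: nn_integral_restrict_space)
qed

lemma emeasure_torus_space: "emeasure (torus d) (space (torus d)) = 1"
  using nn_integral_torus_prod[of "\<lambda>_. 1" d] by simp

lemma measurable_torus_component [measurable]:
  assumes "j \<in> {1..d}" shows "(\<lambda>x. x j) \<in> borel_measurable (torus d)"
proof -
  have "(\<lambda>x. x j) \<in> torus d \<rightarrow>\<^sub>M restrict_space lborel {0..<1}"
    unfolding torus_def using assms by (rule measurable_component_singleton)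
  then show ?thesis by (simp add: measurable_restrict_space2_iff)
qed

section \<open>The maximal function at the critical exponent\<close>

lemma weyl_maximal_nonneg: "0 \<le> weyl_maximal d N x"
  unfolding weyl_maximal_def
  by (rule cSUP_upper2[OF weyl_maximal_bdd_above, where x = "1 / 2"]) auto

lemma weyl_maximal_le: "weyl_maximal d N x \<le> real N ^ d"
  unfolding weyl_maximal_def by (rule cSUP_least) (auto intro: norm_prod_weyl_sum_le[unfolded One_nat_def])

text \<open>At the critical exponent,
  \<open>m powr (2 + 2 / d) = (m\<^sup>2) powr (1 / d) * m\<^sup>2\<close>. The first factor is
  bounded through the \<open>x\<close>-free estimate of all \<open>d\<close> sums, whose
  \<open>d\<close>-th root gives a single \<open>N\<^sup>2 / q\<close>. The second is bounded by the
  product that depends on \<open>x\<close>.\<close>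

definition majorant :: "nat \<Rightarrow> nat \<Rightarrow> nat \<Rightarrow> (nat \<Rightarrow> real) \<Rightarrow> real" where
  "majorant d N q x = 50 * (1 + ln (2 * real N)) * ((real N)\<^sup>2 / real q)
    * (\<Prod>j=1..d. 100 * (1 + ln (2 * real N)) * (real N / (nu (real (2 * q) * x j) + 1 / real N)))"

lemma majorant_nonneg: "1 \<le> N \<Longrightarrow> 0 \<le> majorant d N q x"
  unfolding majorant_def by (intro mult_nonneg_nonneg prod_nonneg) (auto simp: ln_ge_zero)

text \<open>The denominator \<open>q\<close> varies with \<open>t\<close>. Summing the nonnegative
  majorants over all \<open>q\<close> gives a bound free of \<open>t\<close>, so the supremum can be
  taken.\<close>

lemma weyl_maximal_powr_le:
  assumes N: "1 \<le> N" and d: "1 \<le> d"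
  shows "weyl_maximal d N x powr (2 + 2 / real d) \<le> (\<Sum>q=1..2*N. majorant d N q x)"
proof -
  define S where "S = (\<Sum>q=1..2*N. majorant d N q x)"
  define P where "P = 2 + 2 / real d"
  have P: "0 < P" using d by (simp add: P_def add_pos_nonneg)
  have S: "0 \<le> S" unfolding S_def by (intro sum_nonneg majorant_nonneg N)
  have "cmod (\<Prod>j=1..d. weyl_sum N (x j) t) \<le> S powr (1 / P)" for t
  proof -
    define m where "m = cmod (\<Prod>j=1..d. weyl_sum N (x j) t)"
    obtain q where q: "q \<in> {1..2 * N}"
      "\<And>x. (cmod (weyl_sum N x t))\<^sup>2 \<le> 50 * (1 + ln (2 * real N)) * ((real N)\<^sup>2 / real q)"
      "\<And>x. (cmod (weyl_sum N x t))\<^sup>2 \<le> 100 * (1 + ln (2 * real N)) * (real N / (nu (real (2 * q) * x) + 1 / real N))"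
      using weyl_sum_uniform_bound[OF N] by metis
    define A where "A = 50 * (1 + ln (2 * real N)) * ((real N)\<^sup>2 / real q)"
    have A: "0 \<le> A" using N by (simp add: A_def ln_ge_zero)
    have m2: "m\<^sup>2 = (\<Prod>j=1..d. (cmod (weyl_sum N (x j) t))\<^sup>2)"
      by (simp add: m_def prod_norm[symmetric] prod_power_distrib)
    have "m\<^sup>2 \<le> (\<Prod>j=1..d. A)" unfolding m2 by (intro prod_mono) (use q A_def in auto)
    then have "(m\<^sup>2) powr (1 / real d) \<le> (A ^ d) powr (1 / real d)"
      by (intro powr_mono2) auto
    also have "\<dots> = A" using A d by (cases "A = 0") (simp_all add: powr_powr flip: powr_realpow)
    finally have root: "(m\<^sup>2) powr (1 / real d) \<le> A" .
    have "m powr P = (m\<^sup>2) powr (1 / real d) * m\<^sup>2"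
    proof (cases "m = 0")
      case False
      then have "0 < m" by (simp add: m_def)
      then show ?thesis by (simp add: P_def powr_add powr_powr mult.commute flip: powr_numeral)
    qed simp
    also have "\<dots> \<le> A * (\<Prod>j=1..d. 100 * (1 + ln (2 * real N)) * (real N / (nu (real (2 * q) * x j) + 1 / real N)))"
    proof (rule mult_mono[OF root _ A])
      show "m\<^sup>2 \<le> (\<Prod>j=1..d. 100 * (1 + ln (2 * real N)) * (real N / (nu (real (2 * q) * x j) + 1 / real N)))"
        unfolding m2 by (intro prod_mono conjI q) auto
    qed simp
    also have "\<dots> = majorant d N q x" by (simp add: majorant_def A_def)
    also have "\<dots> \<le> S"
      unfolding S_def using q(1) by (intro member_le_sum majorant_nonneg N) auto
    finally have "(m powr P) powr (1 / P) \<le> S powr (1 / P)"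
      using P by (intro powr_mono2) auto
    then show ?thesis using P by (simp add: powr_powr m_def)
  qed
  then have "weyl_maximal d N x \<le> S powr (1 / P)"
    unfolding weyl_maximal_def by (intro cSUP_least) auto
  then have "weyl_maximal d N x powr P \<le> (S powr (1 / P)) powr P"
    using P by (intro powr_mono2 weyl_maximal_nonneg) auto
  also have "\<dots> = S" using P S by (simp add: powr_powr)
  finally show ?thesis by (simp add: P_def S_def)
qed

text \<open>The integral factors over the coordinates, and by periodicity the dilation by
  \<open>2 * q\<close> does not change any factor. The denominator enters only through
  \<open>1 / q\<close>.\<close>

lemma nn_integral_majorant_le:
  assumes N: "1 \<le> N" and q: "1 \<le> q"
  shows "(\<integral>\<^sup>+x. ennreal (majorant d N q x) \<partial>torus d)
    \<le> ennreal (50 * 100 ^ d * (1 + ln (2 * real N)) ^ (2 * d + 1) * real N ^ (d + 2) * (1 / real q))"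
proof -
  define \<Lambda> where "\<Lambda> = 1 + ln (2 * real N)"
  have L: "0 \<le> \<Lambda>" using N by (simp add: \<Lambda>_def ln_ge_zero)
  define F where "F y = ennreal (1 / (nu y + 1 / real N))" for y
  define c where "c = 50 * \<Lambda> * ((real N)\<^sup>2 / real q) * (100 * \<Lambda> * real N) ^ d"
  have c: "0 \<le> c" using L by (simp add: c_def)
  have [measurable]: "F \<in> borel_measurable borel" unfolding F_def by measurable
  have "ennreal (majorant d N q x) = ennreal c * (\<Prod>j=1..d. F (real (2 * q) * x j))" for x
  proof -
    have "majorant d N q x = c * (\<Prod>j=1..d. 1 / (nu (real (2 * q) * x j) + 1 / real N))"
    proof -
      have "(\<Prod>j=1..d. 100 * \<Lambda> * (real N / (nu (real (2 * q) * x j) + 1 / real N)))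
          = (\<Prod>j=1..d. (100 * \<Lambda> * real N) * (1 / (nu (real (2 * q) * x j) + 1 / real N)))"
        by (intro prod.cong) auto
      also have "\<dots> = (100 * \<Lambda> * real N) ^ d * (\<Prod>j=1..d. 1 / (nu (real (2 * q) * x j) + 1 / real N))"
        by (subst prod.distrib) simp
      finally show ?thesis unfolding majorant_def c_def \<Lambda>_def[symmetric] by (simp only: mult_ac)
    qed
    then show ?thesis
      using c by (simp add: F_def ennreal_mult prod_nonneg prod_ennreal del: of_nat_mult)
  qed
  then have "(\<integral>\<^sup>+x. ennreal (majorant d N q x) \<partial>torus d)
      = ennreal c * (\<integral>\<^sup>+x. (\<Prod>j=1..d. F (real (2 * q) * x j)) \<partial>torus d)"
    by (simp add: nn_integral_cmult)
  also have "(\<integral>\<^sup>+x. (\<Prod>j=1..d. F (real (2 * q) * x j)) \<partial>torus d)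
      = (\<integral>\<^sup>+y. F (real (2 * q) * y) * indicator {0..<1} y \<partial>lborel) ^ d"
    by (rule nn_integral_torus_prod) measurable
  also have "(\<integral>\<^sup>+y. F (real (2 * q) * y) * indicator {0..<1} y \<partial>lborel) = (\<integral>\<^sup>+y. F y * indicator {0..<1} y \<partial>lborel)"
  proof (rule nn_integral_periodic_dilation)
    show "F (y + 1) = F y" for y using nu_add_int[of y 1] by (simp add: F_def)
  qed (use q in auto)
  also have "\<dots> ^ d \<le> ennreal \<Lambda> ^ d"
    unfolding F_def \<Lambda>_def by (intro power_mono nn_integral_inverse_nu_le N) auto
  also have "ennreal c * ennreal \<Lambda> ^ d = ennreal (c * \<Lambda> ^ d)"
    using c L by (simp add: ennreal_mult ennreal_power)
  also have "c * \<Lambda> ^ d = 50 * 100 ^ d * \<Lambda> ^ (2 * d + 1) * real N ^ (d + 2) * (1 / real q)"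
    by (simp add: c_def power_mult_distrib power_add power_mult power2_eq_square field_simps)
  finally show ?thesis by (simp add: \<Lambda>_def mult_left_mono)
qed

lemma nn_integral_weyl_maximal_critical_le:
  assumes N: "1 \<le> N" and d: "1 \<le> d"
  shows "(\<integral>\<^sup>+x. ennreal (weyl_maximal d N x powr (2 + 2 / real d)) \<partial>torus d)
    \<le> ennreal (50 * 100 ^ d * (1 + ln (2 * real N)) ^ (2 * d + 2) * real N ^ (d + 2))"
proof -
  define \<Lambda> where "\<Lambda> = 1 + ln (2 * real N)"
  have L: "0 \<le> \<Lambda>" using N by (simp add: \<Lambda>_def ln_ge_zero)
  define B where "B = 50 * 100 ^ d * \<Lambda> ^ (2 * d + 1) * real N ^ (d + 2)"
  have B: "0 \<le> B" using L by (simp add: B_def)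
  have [measurable]: "(\<lambda>x. majorant d N q x) \<in> borel_measurable (torus d)" for q
    unfolding majorant_def
    by (intro borel_measurable_times borel_measurable_prod borel_measurable_divide borel_measurable_add
        measurable_compose[OF _ measurable_nu] borel_measurable_const measurable_torus_component)
  have "(\<integral>\<^sup>+x. ennreal (weyl_maximal d N x powr (2 + 2 / real d)) \<partial>torus d)
      \<le> (\<integral>\<^sup>+x. (\<Sum>q=1..2*N. ennreal (majorant d N q x)) \<partial>torus d)"
  proof (intro nn_integral_mono)
    fix x
    show "ennreal (weyl_maximal d N x powr (2 + 2 / real d)) \<le> (\<Sum>q=1..2*N. ennreal (majorant d N q x))"
      by (subst sum_ennreal) (intro majorant_nonneg N ennreal_leI weyl_maximal_powr_le[OF N d])+
  qed
  also have "\<dots> = (\<Sum>q=1..2*N. \<integral>\<^sup>+x. ennreal (majorant d N q x) \<partial>torus d)"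
    by (rule nn_integral_sum) measurable
  also have "\<dots> \<le> (\<Sum>q=1..2*N. ennreal (B * (1 / real q)))"
    unfolding B_def \<Lambda>_def by (intro sum_mono nn_integral_majorant_le N) auto
  also have "\<dots> = ennreal (B * harm (2 * N))"
    using B by (subst sum_ennreal) (auto simp: harm_def sum_distrib_left inverse_eq_divide)
  also have "\<dots> \<le> ennreal (B * \<Lambda>)"
    using harm_le_one_plus_ln[of "2 * N"] N B by (intro ennreal_leI mult_left_mono) (auto simp: \<Lambda>_def)
  also have "B * \<Lambda> = 50 * 100 ^ d * \<Lambda> ^ (2 * d + 2) * real N ^ (d + 2)" by (simp add: B_def)
  finally show ?thesis by (simp add: \<Lambda>_def)
qed

section \<open>From the critical exponent to all exponents\<close>

lemma log_power_le_powr: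
  fixes \<epsilon> :: real
  assumes "0 < \<epsilon>"
  obtains C where "0 < C" "\<And>N::nat. 1 \<le> N \<Longrightarrow> (1 + ln (2 * real N)) ^ k \<le> C * real N powr \<epsilon>"
proof -
  \<comment> \<open>Each of the \<open>k\<close> logarithms may cost \<open>N powr a\<close>.
    Dividing by \<open>Suc k\<close> also handles \<open>k = 0\<close>.\<close>
  define a where "a = \<epsilon> / real (Suc k)"
  have a: "0 < a" using assms by (simp add: a_def)
  show ?thesis
  proof (rule that)
    show "0 < (2 + 1 / a) ^ k" using a by (simp add: add_pos_pos)
    fix N :: nat assume N: "1 \<le> N"
    have "1 \<le> real N powr a" using N a by (simp add: ge_one_powr_ge_zero)
    have "1 + ln (2 * real N) = 1 + ln 2 + ln (real N)" using N by (simp add: ln_mult_pos)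
    also have "\<dots> \<le> 2 * real N powr a + real N powr a / a"
      using ln_powr_bound[of "real N" a] N a ln_2_less_1 \<open>1 \<le> real N powr a\<close> by linarith
    also have "\<dots> = (2 + 1 / a) * real N powr a" by (simp add: algebra_simps)
    finally have "(1 + ln (2 * real N)) ^ k \<le> ((2 + 1 / a) * real N powr a) ^ k"
      using N by (intro power_mono) (auto simp: ln_ge_zero)
    also have "\<dots> = (2 + 1 / a) ^ k * real N powr (a * real k)"
      using N by (simp add: power_mult_distrib powr_powr flip: powr_realpow)
    also have "\<dots> \<le> (2 + 1 / a) ^ k * real N powr \<epsilon>"
    proof (intro mult_left_mono powr_mono)
      show "a * real k \<le> \<epsilon>" using assms by (simp add: a_def field_simps)
    qed (use N a in auto)
    finally show "(1 + ln (2 * real N)) ^ k \<le> (2 + 1 / a) ^ k * real N powr \<epsilon>" .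
  qed
qed

text \<open>A finite bound on the integral rules out the infinite branch of
  \<open>Lp_norm\<close>.\<close>

lemma Lp_norm_le:
  assumes "0 < p" "0 \<le> B" and le: "(\<integral>\<^sup>+x. ennreal (\<bar>f x\<bar> powr p) \<partial>M) \<le> ennreal B"
  shows "Lp_norm p M f \<le> ennreal (B powr (1 / p))"
proof -
  define I where "I = (\<integral>\<^sup>+x. ennreal (\<bar>f x\<bar> powr p) \<partial>M)"
  have "I \<noteq> \<infinity>" "enn2real I \<le> B"
    using le \<open>0 \<le> B\<close> unfolding I_def[symmetric] by (auto simp: enn2real_leI top_unique)
  then have "enn2real I powr (1 / p) \<le> B powr (1 / p)"
    using assms(1) by (intro powr_mono2) auto
  then show ?thesis
    using \<open>I \<noteq> \<infinity>\<close> unfolding Lp_norm_def I_def[symmetric] by (simp add: ennreal_leI)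
qed

theorem theorem1p1:
  fixes d :: nat and p s :: real
  assumes "d \<ge> 2" and "1 \<le> p"
    and "p \<le> 2 * (real d + 1) / real d \<Longrightarrow> s > real d / (2 * (real d + 1))"
    and "p \<ge> 2 * (real d + 1) / real d \<Longrightarrow> s > real d / 2 - real d / p"
  shows "\<exists>C>0. \<forall>N\<ge>1. Lp_norm p (torus d) (weyl_maximal d N)
           \<le> ennreal (C * real N powr (real d / 2 + s))"
proof -
  define P where "P = 2 + 2 / real d"
  have d: "0 < real d" using assms(1) by simp
  have P: "P = 2 * (real d + 1) / real d" using d by (simp add: P_def field_simps)
  \<comment> \<open>\<open>real N powr \<kappa>\<close> is the size below which the maximal function need not be examined.\<close>
  define \<kappa> where "\<kappa> = real d / 2 + real d / (2 * (real d + 1))"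
  \<comment> \<open>So the \<open>P\<close>-th power of the height \<open>N powr \<kappa>\<close>
    has, up to logarithms and constants, the size of the critical moment.\<close>
  have \<kappa>P: "\<kappa> * P = real d + 2" using d add_pos_pos[OF d zero_less_one] unfolding \<kappa>_def P
    by (simp add: divide_simps) (simp add: algebra_simps)
  \<comment> \<open>The order of the \<open>p\<close>-th moment without logarithms. Below
    \<open>P\<close> the height \<open>N powr \<kappa>\<close> dictates it. Otherwise the trivial
    bound \<open>N powr d\<close> on \<open>p - P\<close> factors leaves
    \<open>d * (p - P) + (d + 2) = d * p - d\<close>.\<close>
  define e where "e = (if p < P then \<kappa> * p else real d * p - real d)"
  \<comment> \<open>The slack provided by the strict lower bound on \<open>s\<close>, to be spent on
    the logarithms.\<close>
  define \<epsilon> where "\<epsilon> = p * (real d / 2 + s) - e"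
  have \<epsilon>: "0 < \<epsilon>"
  proof (cases "p < P")
    case True
    then have "p * (real d / 2 + s) > p * \<kappa>"
      using assms(2,3) by (intro mult_strict_left_mono) (auto simp: P \<kappa>_def)
    then show ?thesis using True by (simp add: \<epsilon>_def e_def mult.commute)
  next
    case False
    then have "p * (real d / 2 + s) > p * (real d - real d / p)"
      using assms(2,4) by (intro mult_strict_left_mono) (auto simp: P)
    then show ?thesis using False assms(2) by (simp add: \<epsilon>_def e_def algebra_simps)
  qed
  obtain K where K: "0 < K" "\<And>N::nat. 1 \<le> N \<Longrightarrow> (1 + ln (2 * real N)) ^ (2 * d + 2) \<le> K * real N powr \<epsilon>"
    using log_power_le_powr[OF \<epsilon>] by metis
  define B where "B = 1 + 50 * 100 ^ d * K"
  have B: "0 < B" using K by (simp add: B_def add_pos_pos)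
  have bound: "(\<integral>\<^sup>+x. ennreal (\<bar>weyl_maximal d N x\<bar> powr p) \<partial>torus d) \<le> ennreal (B * real N powr (e + \<epsilon>))"
    if N: "1 \<le> N" for N
  proof -
    define W where "W = weyl_maximal d N"
    have W: "0 \<le> W x" "W x \<le> real N powr real d" for x
      using weyl_maximal_nonneg weyl_maximal_le N by (simp_all add: W_def powr_realpow)
    have [measurable]: "W \<in> borel_measurable (torus d)"
      unfolding W_def by (rule weyl_maximal_measurable)
    have crit: "(\<integral>\<^sup>+x. ennreal (W x powr P) \<partial>torus d) \<le> ennreal (50 * 100 ^ d * K * real N powr (real d + 2 + \<epsilon>))"
    proof -
      have "50 * 100 ^ d * (1 + ln (2 * real N)) ^ (2 * d + 2) * real N ^ (d + 2)
          \<le> 50 * 100 ^ d * (K * real N powr \<epsilon>) * real N ^ (d + 2)"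
        by (intro mult_right_mono mult_left_mono K N) auto
      also have "\<dots> = 50 * 100 ^ d * K * real N powr (real d + 2 + \<epsilon>)"
      proof -
        have "real N ^ (d + 2) = real N powr (real d + 2)"
          using N powr_realpow[of "real N" "d + 2"] by (simp add: add.commute)
        then show ?thesis by (simp add: powr_add)
      qed
      finally have le: "50 * 100 ^ d * (1 + ln (2 * real N)) ^ (2 * d + 2) * real N ^ (d + 2)
          \<le> 50 * 100 ^ d * K * real N powr (real d + 2 + \<epsilon>)" .
      show ?thesis
        unfolding W_def P_def
        by (rule order_trans[OF nn_integral_weyl_maximal_critical_le[OF N] ennreal_leI[OF le]])
           (use assms(1) in simp)
    qed
    define \<theta> where "\<theta> = e - (real d + 2)"
    \<comment> \<open>For \<open>p < P\<close>, values up to \<open>N powr \<kappa>\<close> are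
      covered by the constant, and above it the negative power \<open>p - P\<close> of
      \<open>W x\<close> is largest at that height. For \<open>p \<ge> P\<close>, the power
      \<open>p - P\<close> is bounded through \<open>W x \<le> N powr d\<close>.\<close>
    have "W x powr p \<le> real N powr e + real N powr \<theta> * W x powr P" for x
    proof (cases "p < P")
      case True
      then have \<theta>: "\<theta> = \<kappa> * (p - P)" by (simp add: \<theta>_def e_def right_diff_distrib \<kappa>P)
      show ?thesis
      proof (cases "W x \<le> real N powr \<kappa>")
        case small: True
        then have "W x powr p \<le> (real N powr \<kappa>) powr p" using W assms(2) by (intro powr_mono2) auto
        then show ?thesis using True by (simp add: powr_powr e_def add_increasing2)
      next
        case False
        have Npos: "0 < real N powr \<kappa>" using N by simp
        have "W x powr p = W x powr (p - P) * W x powr P" by (simp flip: powr_add)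
        also have "\<dots> \<le> (real N powr \<kappa>) powr (p - P) * W x powr P"
          using False True Npos by (intro mult_right_mono powr_mono2') auto
        finally show ?thesis by (simp add: powr_powr \<theta> add_increasing)
      qed
    next
      case False
      have \<theta>: "\<theta> = real d * (p - P)"
        using False d by (simp add: \<theta>_def e_def P_def field_simps)
      have "W x powr p = W x powr (p - P) * W x powr P" by (simp flip: powr_add)
      also have "\<dots> \<le> (real N powr real d) powr (p - P) * W x powr P"
        using False W by (intro mult_right_mono powr_mono2) auto
      finally show ?thesis by (simp add: powr_powr \<theta> add_increasing)
    qed
    then have "(\<integral>\<^sup>+x. ennreal (\<bar>W x\<bar> powr p) \<partial>torus d)
        \<le> (\<integral>\<^sup>+x. ennreal (real N powr e) + ennreal (real N powr \<theta>) * ennreal (W x powr P) \<partial>torus d)"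
      using W(1) by (intro nn_integral_mono) (simp add: ennreal_leI flip: ennreal_mult ennreal_plus)
    also have "\<dots> = ennreal (real N powr e) + ennreal (real N powr \<theta>) * (\<integral>\<^sup>+x. ennreal (W x powr P) \<partial>torus d)"
      by (simp add: nn_integral_add nn_integral_cmult emeasure_torus_space)
    also have "\<dots> \<le> ennreal (real N powr e)
        + ennreal (real N powr \<theta>) * ennreal (50 * 100 ^ d * K * real N powr (real d + 2 + \<epsilon>))"
      by (intro add_left_mono mult_left_mono crit) auto
    also have "\<dots> = ennreal (real N powr e + 50 * 100 ^ d * K * (real N powr \<theta> * real N powr (real d + 2 + \<epsilon>)))"
      using K by (simp add: mult_ac flip: ennreal_mult ennreal_plus)
    also have "real N powr \<theta> * real N powr (real d + 2 + \<epsilon>) = real N powr (e + \<epsilon>)"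
      by (simp add: \<theta>_def flip: powr_add)
    also have "ennreal (real N powr e + 50 * 100 ^ d * K * real N powr (e + \<epsilon>)) \<le> ennreal (B * real N powr (e + \<epsilon>))"
    proof (intro ennreal_leI)
      have "real N powr e \<le> real N powr (e + \<epsilon>)" using N \<epsilon> by (intro powr_mono) auto
      then show "real N powr e + 50 * 100 ^ d * K * real N powr (e + \<epsilon>) \<le> B * real N powr (e + \<epsilon>)"
        by (simp add: B_def algebra_simps)
    qed
    finally show ?thesis by (simp add: W_def)
  qed
  have "Lp_norm p (torus d) (weyl_maximal d N) \<le> ennreal (B powr (1 / p) * real N powr (real d / 2 + s))"
    if N: "1 \<le> N" for N
  proof -
    have "Lp_norm p (torus d) (weyl_maximal d N) \<le> ennreal ((B * real N powr (e + \<epsilon>)) powr (1 / p))"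
      by (rule Lp_norm_le[OF _ _ bound[OF N]]) (use assms(2) B in auto)
    also have "(B * real N powr (e + \<epsilon>)) powr (1 / p) = B powr (1 / p) * real N powr (real d / 2 + s)"
      using B assms(2) by (simp add: powr_mult powr_powr \<epsilon>_def)
    finally show ?thesis .
  qed
  then show ?thesis using B by (intro exI[of _ "B powr (1 / p)"]) auto
qed

end
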